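(* Let $X$ be a Fréchet sequence space over $\mathbb{Z}$, endowed with an increasing sequence $(\|\cdot\|_n)_{n\in\mathbb{N}}$ of seminorms, in which the sequence $(e_n)_{n\in\mathbb{Z}}$ of canonical vectors is a basis. Suppose that the bilateral weighted backward shift $B_w$, with nonzero weights $w:=(w_n)_{n\in\mathbb{Z}}$, is well-defined and continuous on $X$. Then $B_w$ is distributionally chaotic if and only if there exist $D\subset\mathbb{N}$ with $\overline{\operatorname{dens}}(D)=1$ and $I\subset\mathbb{Z}$ such that the following conditions hold: (A) For all $i\in I$, we have $\lim_{n\in D} w_{i-n}\cdots w_{i-1}e_{i-n}=0$ (convergence in $X$ as $n\to\infty$ with $n\in D$). (B) There exist $m\in\mathbb{N}$ and an increasing sequence $(N_k)_{k\in\mathbb{N}}$ of positive integers such that for each $k\in\mathbb{N}$ there are $r:=r(k)\in\mathbb{N}$, indices $i_{1,k},\dots,i_{r,k}\in I$ and scalars $b_{1,k},\dots,b_{r,k}\in\mathbb{K}\setminus\{0\}$ with $\left\|\sum_{j=1}^{r}b_{j,k}e_{i_{j,k}}\right\|_{p(k)}\neq 0$ and $$\operatorname{card}\left\{1\le n\le N_k:\frac{\left\|\sum_{j=1}^{r}b_{j,k}w_{i_{j,k}-n}\cdots w_{i_{j,k}-1}e_{i_{j,k}-n}\right\|_{m}}{\left\|\sum_{j=1}^{r}b_{j,k}e_{i_{j,k}}\right\|_{p(k)}}>k\right\}>(1-k^{-1})N_k,$$ where $p(k):=m$ if $1\le k\le m$, and $p(k):=k$ if $k>m$.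
   Context: $\mathbb{K}$ is $\mathbb{R}$ or $\mathbb{C}$; $\mathbb{N}=\{1,2,3,\dots\}$. A Fréchet space is a vector space $X$ over $\mathbb{K}$ endowed with an increasing sequence $(\|\cdot\|_k)_{k\in\mathbb{N}}$ of seminorms such that $d(x,y):=\sum_{k=1}^{\infty}2^{-k}\min\{1,\|x-y\|_k\}$ is a metric under which $X$ is complete; $X$ is always considered with this metric $d$. A Fréchet sequence space over $\mathbb{Z}$ is a Fréchet space $X$ that is a vector subspace of $\mathbb{K}^{\mathbb{Z}}$ such that the inclusion $X\to\mathbb{K}^{\mathbb{Z}}$ is continuous (convergence in $X$ implies coordinatewise convergence). The canonical vectors $e_n:=(\delta_{n,j})_{j\in\mathbb{Z}}$, $n\in\mathbb{Z}$, form a basis of $X$ if they belong to $X$ and $x=\sum_{n=-\infty}^{\infty}x_ne_n$ in $X$ for every $x=(x_n)_{n\in\mathbb{Z}}\in X$ (as usual, a two-sided series converges when both $\sum_{n\ge 0}$ and $\sum_{n<0}$ converge in $X$). For a sequence $w=(w_n)_{n\in\mathbb{Z}}$ of nonzero scalars, the bilateral weighted backward shift is $B_w((x_n)_{n\in\mathbb{Z}}):=(w_nx_{n+1})_{n\in\mathbb{Z}}$; it is well-defined on $X$ if it maps $X$ into itself. For $A\subset\mathbb{N}$, $\overline{\operatorname{dens}}(A):=\limsup_{N\to\infty}\frac{\operatorname{card}(\{1,\dots,N\}\cap A)}{N}$. A map $f:M\to M$ on a metric space $(M,d)$ is distributionally chaotic if there exist an uncountable set $\Gamma\subset M$ and $\varepsilon>0$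 such that for each pair $(x,y)$ of distinct points of $\Gamma$, $$\liminf_{k\to\infty}\frac{\operatorname{card}\{n\in\{1,\dots,k\}:d(f^n(x),f^n(y))<\varepsilon\}}{k}=0$$ and, for all $\tau>0$, $$\limsup_{k\to\infty}\frac{\operatorname{card}\{n\in\{1,\dots,k\}:d(f^n(x),f^n(y))<\tau\}}{k}=1.$$ *)

theory Defs
  imports "HOL-Analysis.Analysis" "HOL-Library.Function_Algebras"
begin

(* The scalar field is a type 'k of class {real_normed_field, banach}.  By Gelfand-Mazur the
   instances of this class are, up to isometric isomorphism, exactly the reals and the complex
   numbers.

   Seminorms are indexed by the positive integers: of p :: nat => _ only p 1, p 2, ... matter, and
   only their values on the carrier X. *)

definition seminorm_on ::
  "('k::real_normed_field \<Rightarrow> 'a::ab_group_add \<Rightarrow> 'a) \<Rightarrow> 'a set \<Rightarrow> ('a \<Rightarrow> real) \<Rightarrow> bool" where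
  "seminorm_on smul X q \<longleftrightarrow>
     (\<forall>x\<in>X. 0 \<le> q x) \<and>
     (\<forall>x\<in>X. \<forall>y\<in>X. q (x + y) \<le> q x + q y) \<and>
     (\<forall>c. \<forall>x\<in>X. q (smul c x) = norm c * q x)"

(* The summation index is shifted: the k-th summand (k = 0, 1, ...) belongs to the seminorm p (k+1).
   The value 0 off X is junk, needed because the library locale Metric_space asks for a
   nonnegative symmetric function on the whole type. *)
definition frechet_dist ::
  "'a::ab_group_add set \<Rightarrow> (nat \<Rightarrow> 'a \<Rightarrow> real) \<Rightarrow> 'a \<Rightarrow> 'a \<Rightarrow> real" where
  "frechet_dist X p x y =
     (if x \<in> X \<and> y \<in> X then \<Sum>k. (1/2) ^ Suc k * min 1 (p (Suc k) (x - y)) else 0)"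

abbreviation frechet_topology ::
  "'a::ab_group_add set \<Rightarrow> (nat \<Rightarrow> 'a \<Rightarrow> real) \<Rightarrow> 'a topology" where
  "frechet_topology X p \<equiv> Metric_space.mtopology X (frechet_dist X p)"

locale frechet_space = vector_space smul
  for smul :: "'k::{real_normed_field,banach} \<Rightarrow> 'a::ab_group_add \<Rightarrow> 'a" +
  fixes X :: "'a set" and p :: "nat \<Rightarrow> 'a \<Rightarrow> real"
  assumes subspace_carrier: "module.subspace smul X"
    and seminorms: "\<And>k. 1 \<le> k \<Longrightarrow> seminorm_on smul X (p k)"
    and seminorms_mono: "\<And>j k x. 1 \<le> j \<Longrightarrow> j \<le> k \<Longrightarrow> x \<in> X \<Longrightarrow> p j x \<le> p k x"
    and metric: "Metric_space X (frechet_dist X p)"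
    and complete: "Metric_space.mcomplete X (frechet_dist X p)"

definition seq_scale :: "'k::real_normed_field \<Rightarrow> (int \<Rightarrow> 'k) \<Rightarrow> (int \<Rightarrow> 'k)" where
  "seq_scale c x = (\<lambda>i. c * x i)"

locale frechet_sequence_space = frechet_space seq_scale X p
  for X :: "(int \<Rightarrow> 'k::{real_normed_field,banach}) set" and p :: "nat \<Rightarrow> (int \<Rightarrow> 'k) \<Rightarrow> real" +
  assumes continuous_inclusion:
    "continuous_map (frechet_topology X p) (product_topology (\<lambda>_. euclidean) UNIV) (\<lambda>x. x)"

definition canonical_vec :: "int \<Rightarrow> (int \<Rightarrow> 'k::real_normed_field)" where
  "canonical_vec n = (\<lambda>j. if j = n then 1 else 0)"

definition canonical_basis ::
  "(int \<Rightarrow> 'k::real_normed_field) set \<Rightarrow> (nat \<Rightarrow> (int \<Rightarrow> 'k) \<Rightarrow> real) \<Rightarrow> bool" where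
  "canonical_basis X p \<longleftrightarrow>
     range canonical_vec \<subseteq> X \<and>
     (\<forall>x\<in>X. \<exists>u v.
        limitin (frechet_topology X p)
          (\<lambda>N. \<Sum>n\<le>N. seq_scale (x (int n)) (canonical_vec (int n))) u sequentially \<and>
        limitin (frechet_topology X p)
          (\<lambda>N. \<Sum>n=1..N. seq_scale (x (- int n)) (canonical_vec (- int n))) v sequentially \<and>
        x = u + v)"

definition backward_shift :: "(int \<Rightarrow> 'k::real_normed_field) \<Rightarrow> (int \<Rightarrow> 'k) \<Rightarrow> (int \<Rightarrow> 'k)" where
  "backward_shift w x = (\<lambda>n. w n * x (n + 1))"

definition upper_density :: "nat set \<Rightarrow> ereal" where
  "upper_density A = limsup (\<lambda>N. ereal (real (card ({1..N} \<inter> A)) / real N))"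

definition distributionally_chaotic ::
  "'a set \<Rightarrow> ('a \<Rightarrow> 'a \<Rightarrow> real) \<Rightarrow> ('a \<Rightarrow> 'a) \<Rightarrow> bool" where
  "distributionally_chaotic M d f \<longleftrightarrow>
     (\<exists>\<Gamma>\<subseteq>M. uncountable \<Gamma> \<and>
        (\<exists>\<epsilon>>0. \<forall>x\<in>\<Gamma>. \<forall>y\<in>\<Gamma>. x \<noteq> y \<longrightarrow>
           liminf (\<lambda>k. ereal (real (card {n\<in>{1..k}. d ((f ^^ n) x) ((f ^^ n) y) < \<epsilon>}) / real k)) = 0 \<and>
           (\<forall>\<tau>>0.
             limsup (\<lambda>k. ereal (real (card {n\<in>{1..k}. d ((f ^^ n) x) ((f ^^ n) y) < \<tau>}) / real k)) = 1)))"

(* w_(i-n) ... w_(i-1) *)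
definition weight_prod :: "(int \<Rightarrow> 'k::real_normed_field) \<Rightarrow> int \<Rightarrow> nat \<Rightarrow> 'k" where
  "weight_prod w i n = (\<Prod>j=1..n. w (i - int j))"

end

(* Sufficiency: T^n v -> 0 along D for every v in V = span {e_i. i \<in> I}.  In the closure of V,
   the vectors whose orbit is, for arbitrarily long stretches of time, mostly close to 0, and those
   whose orbit is mostly large in the m-th seminorm, form dense G_delta sets; the second density is
   obtained by adding to v \<in> V one of several small multiples of a vector from (B).  By Baire some
   u has both properties, and the line of real multiples of u is a scrambled set.

   Necessity: let u be the difference of two points of a scrambled pair and let D have upper density
   1 with T^n u -> 0 along D.  The maps x |-> x_n e_n are equicontinuous by the uniform boundedness
   principle, so the coordinates of the vectors T^s u give (A).  For s \<in> D large, T^s u is small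
   while its orbit is as large as that of u; truncations of T^s u give (B). *)
theory Submission
  imports Defs
begin

section \<open>Sets of upper density one\<close>

text \<open>Sets of upper density one are not closed under intersection; two of them can even be
  disjoint. Small orbits can be added only because one D serves all the vectors involved. For a
  vector in the closure, the small and the large times are never intersected: two separate open
  conditions produce them, at unrelated lengths N, and its small times need not come from D.

  The ratio in (B) does not change under scaling, so its vectors can be normalised. The growing
  index p(k) in the denominator then makes the normalised vector small in any prescribed seminorm,
  while the fixed m in the numerator gives one seminorm in which the orbit of u is large. Adding one
  such vector to v might cancel the orbit of v at many times; several multiples of it cannot all do
  so at most times.

  In the converse direction the obstacle is that seminorms may vanish on nonzero vectors, so that a
  truncation may give a zero denominator. A small multiple of one fixed canonical vector then
  repairs it.\<close>

definition full_density :: "(nat \<Rightarrow> bool) \<Rightarrow> bool" where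
  "full_density P \<longleftrightarrow>
     (\<forall>e>0. \<exists>\<^sub>F N in sequentially. (1 - e) * real N < real (card {n\<in>{1..N}. P n}))"

lemma full_densityD:
  assumes "full_density P" "0 < e"
  obtains N where "K \<le> N" "1 \<le> N" "(1 - e) * real N < real (card {n\<in>{1..N}. P n})"
proof -
  have "\<exists>N\<ge>K. (1 - e) * real N < real (card {n\<in>{1..N}. P n})"
    using assms unfolding full_density_def frequently_sequentially by blast
  then obtain N where N: "K \<le> N" "(1 - e) * real N < real (card {n\<in>{1..N}. P n})"
    by blast
  \<comment> \<open>Both sides vanish at N = 0, so the strict inequality excludes it.\<close>
  have "N \<noteq> 0"
    using N(2) by (rule contrapos_pn) simp
  with N that show ?thesis
    by (metis One_nat_def Suc_leI not_gr_zero)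
qed

text \<open>Taking K beyond both the required threshold and 1 / e lets one parameter control the
  accuracy and the length N.\<close>

lemma full_densityI:
  assumes "\<And>K. 1 \<le> K \<Longrightarrow> \<exists>N\<ge>K. (1 - 1 / real K) * real N < real (card {n\<in>{1..N}. P n})"
  shows "full_density P"
  unfolding full_density_def frequently_sequentially
proof (intro allI impI)
  fix e :: real and K0 :: nat
  assume "0 < e"
  then obtain K1 where K1: "inverse (real (Suc K1)) < e"
    using reals_Archimedean by blast
  define K where "K = max K0 (Suc K1)"
  have K: "1 \<le> K" "K0 \<le> K" "Suc K1 \<le> K"
    by (auto simp: K_def)
  have "1 / real K \<le> inverse (real (Suc K1))"
    using K(3) by (simp add: inverse_eq_divide frac_le)
  with K1 have Ke: "1 / real K \<le> e"
    by simp
  obtain N where N: "K \<le> N" "(1 - 1 / real K) * real N < real (card {n\<in>{1..N}. P n})"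
    using assms[OF K(1)] by blast
  have "(1 - e) * real N \<le> (1 - 1 / real K) * real N"
    using Ke by (intro mult_right_mono) auto
  then have "(1 - e) * real N < real (card {n\<in>{1..N}. P n})"
    using N(2) by linarith
  with N K show "\<exists>N\<ge>K0. (1 - e) * real N < real (card {n\<in>{1..N}. P n})"
    using order_trans by blast
qed

text \<open>The predicate may sharpen with K. This is the form in which a point of all the open sets
  of the Baire argument is available: stage K yields only \<open>Q K\<close>, which implies P once K
  is large.\<close>

lemma full_densityI_nested:
  assumes "\<And>K. 1 \<le> K \<Longrightarrow> \<exists>N\<ge>K. (1 - 1 / real K) * real N < real (card {n\<in>{1..N}. Q K n})"
    and "\<And>K n. K0 \<le> K \<Longrightarrow> Q K n \<Longrightarrow> P n"
  shows "full_density P"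
proof (rule full_densityI)
  fix K :: nat assume K: "1 \<le> K"
  define K1 where "K1 = max K K0"
  have "1 \<le> K1"
    using K by (simp add: K1_def)
  then obtain N where N: "K1 \<le> N" "(1 - 1 / real K1) * real N < real (card {n\<in>{1..N}. Q K1 n})"
    using assms(1) by blast
  have "(1 - 1 / real K) * real N \<le> (1 - 1 / real K1) * real N"
    using K by (intro mult_right_mono diff_left_mono frac_le) (auto simp: K1_def)
  moreover have "card {n\<in>{1..N}. Q K1 n} \<le> card {n\<in>{1..N}. P n}"
    by (rule card_mono) (use assms(2)[of K1] in \<open>auto simp: K1_def\<close>)
  ultimately have "(1 - 1 / real K) * real N < real (card {n\<in>{1..N}. P n})"
    using N(2) by linarith
  with N(1) show "\<exists>N\<ge>K. (1 - 1 / real K) * real N < real (card {n\<in>{1..N}. P n})"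
    by (intro exI[of _ N]) (simp add: K1_def)
qed

text \<open>A fixed number c of lost times is at most N / (2 K) as soon as N \<ge> 2 K c, so it uses
  up only half of the tolerance 1 / K.\<close>

lemma full_density_loss:
  assumes "full_density P"
    and "\<And>N. card {n\<in>{1..N}. P n} \<le> card {n\<in>{1..N}. Q n} + c"
  shows "full_density Q"
proof (rule full_densityI)
  fix K :: nat
  assume K: "1 \<le> K"
  have "0 < 1 / (2 * real K)"
    using K by simp
  then obtain N where N: "max K (2 * K * c) \<le> N"
    "(1 - 1 / (2 * real K)) * real N < real (card {n\<in>{1..N}. P n})"
    using full_densityD[OF assms(1)] by blast
  have "real (2 * K * c) \<le> real N"
    using N(1) by (simp only: of_nat_le_iff)
  then have "real c \<le> (1 / (2 * real K)) * real N"
    using K by (simp add: field_simps)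
  moreover have "real (card {n\<in>{1..N}. P n}) \<le> real (card {n\<in>{1..N}. Q n}) + real c"
    using assms(2)[of N] by linarith
  ultimately have "(1 - 1 / (2 * real K)) * real N - (1 / (2 * real K)) * real N
      < real (card {n\<in>{1..N}. Q n})"
    using N(2) by linarith
  also have "(1 - 1 / (2 * real K)) * real N - (1 / (2 * real K)) * real N
      = (1 - 1 / real K) * real N"
    using K by (simp add: field_simps)
  finally show "\<exists>N\<ge>K. (1 - 1 / real K) * real N < real (card {n\<in>{1..N}. Q n})"
    using N(1) by (intro exI[of _ N]) auto
qed

lemma full_density_mono:
  assumes "full_density P" "\<And>n. 1 \<le> n \<Longrightarrow> P n \<Longrightarrow> Q n"
  shows "full_density Q"
  using assms(1)
  by (rule full_density_loss[where c = 0]) (use assms(2) in \<open>auto intro!: card_mono\<close>)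

lemma full_density_tail:
  assumes "full_density P"
  shows "full_density (\<lambda>n. P n \<and> n0 \<le> n)"
  using assms
proof (rule full_density_loss)
  fix N
  have "{n\<in>{1..N}. P n} \<subseteq> {n\<in>{1..N}. P n \<and> n0 \<le> n} \<union> {..<n0}"
    by auto
  then have "card {n\<in>{1..N}. P n} \<le> card ({n\<in>{1..N}. P n \<and> n0 \<le> n} \<union> {..<n0})"
    by (intro card_mono) auto
  also have "\<dots> \<le> card {n\<in>{1..N}. P n \<and> n0 \<le> n} + n0"
    by (rule order_trans[OF card_Un_le]) simp
  finally show "card {n\<in>{1..N}. P n} \<le> card {n\<in>{1..N}. P n \<and> n0 \<le> n} + n0" .
qed

text \<open>Only the first s times are lost. In the necessity proof this lets the orbit of T^s u
  inherit the lower bound known for the orbit of u.\<close>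

lemma full_density_shift:
  assumes "full_density P"
  shows "full_density (\<lambda>n. P (n + s))"
  using assms
proof (rule full_density_loss)
  fix N
  have "{n\<in>{1..N}. P n} \<subseteq> (\<lambda>n. n + s) ` {n\<in>{1..N}. P (n + s)} \<union> {1..s}"
  proof
    fix n assume n: "n \<in> {n\<in>{1..N}. P n}"
    show "n \<in> (\<lambda>n. n + s) ` {n\<in>{1..N}. P (n + s)} \<union> {1..s}"
    proof (cases "n \<le> s")
      case False
      then have "n = (n - s) + s" "n - s \<in> {n\<in>{1..N}. P (n + s)}"
        using n by auto
      then show ?thesis by blast
    qed (use n in auto)
  qed
  then have "card {n\<in>{1..N}. P n} \<le> card ((\<lambda>n. n + s) ` {n\<in>{1..N}. P (n + s)} \<union> {1..s})"
    by (intro card_mono) auto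
  also have "\<dots> \<le> card ((\<lambda>n. n + s) ` {n\<in>{1..N}. P (n + s)}) + s"
    by (rule order_trans[OF card_Un_le]) simp
  also have "\<dots> \<le> card {n\<in>{1..N}. P (n + s)} + s"
    by (simp add: card_image_le)
  finally show "card {n\<in>{1..N}. P n} \<le> card {n\<in>{1..N}. P (n + s)} + s" .
qed

lemma full_density_infinite:
  assumes "full_density P"
  obtains n where "n0 \<le> n" "1 \<le> n" "P n"
proof -
  \<comment> \<open>With e = 1 the lower bound is 0, so strictness already forces a nonempty set of
    times.\<close>
  obtain N where "(1 - 1) * real N < real (card {n\<in>{1..N}. P n \<and> n0 \<le> n})"
    using full_densityD[OF full_density_tail[OF assms], of 1] by (metis zero_less_one)
  then have "{n\<in>{1..N}. P n \<and> n0 \<le> n} \<noteq> {}"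
    by (metis card.empty diff_self mult_zero_left of_nat_0 order_less_irrefl)
  with that show ?thesis by auto
qed

text \<open>Averaging: L disjoint subsets of {1..N} have at most N elements together, so they cannot
  all have more than N / L.\<close>

lemma sparse_index:
  fixes B :: "nat \<Rightarrow> nat \<Rightarrow> bool"
  assumes L: "1 \<le> L"
    and disj: "\<And>n i j. i \<in> {1..L} \<Longrightarrow> j \<in> {1..L} \<Longrightarrow> B i n \<Longrightarrow> B j n \<Longrightarrow> i = j"
  shows "\<exists>j\<in>{1..L}. L * card {n\<in>{1..N}. B j n} \<le> N"
proof (rule ccontr)
  assume "\<not> ?thesis"
  then have "(\<Sum>j\<in>{1..L}. N) < (\<Sum>j\<in>{1..L}. L * card {n\<in>{1..N}. B j n})"
    using L by (intro sum_strict_mono) (auto simp: not_le)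
  also have "\<dots> = L * (\<Sum>j\<in>{1..L}. card {n\<in>{1..N}. B j n})"
    by (rule sum_distrib_left[symmetric])
  also have "(\<Sum>j\<in>{1..L}. card {n\<in>{1..N}. B j n}) = card (\<Union>j\<in>{1..L}. {n\<in>{1..N}. B j n})"
  proof (rule card_UN_disjoint[symmetric])
    show "\<forall>i\<in>{1..L}. \<forall>j\<in>{1..L}. i \<noteq> j \<longrightarrow> {n\<in>{1..N}. B i n} \<inter> {n\<in>{1..N}. B j n} = {}"
      using disj by blast
  qed simp_all
  also have "L * card (\<Union>j\<in>{1..L}. {n\<in>{1..N}. B j n}) \<le> L * card {1..N}"
    by (intro mult_left_mono card_mono) auto
  finally show False
    by simp
qed

section \<open>Limits superior and inferior of frequencies\<close>

lemma limsup_eq_1_iff: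
  fixes f :: "nat \<Rightarrow> real"
  assumes "\<And>n. f n \<le> 1"
  shows "limsup (\<lambda>n. ereal (f n)) = 1 \<longleftrightarrow> (\<forall>e>0. \<exists>\<^sub>F n in sequentially. 1 - e < f n)"
proof (intro iffI allI impI)
  fix e :: real
  assume L: "limsup (\<lambda>n. ereal (f n)) = 1" and e: "0 < e"
  show "\<exists>\<^sub>F n in sequentially. 1 - e < f n"
  proof (rule ccontr)
    assume "\<not> (\<exists>\<^sub>F n in sequentially. 1 - e < f n)"
    then have "\<forall>\<^sub>F n in sequentially. ereal (f n) \<le> ereal (1 - e)"
      by (simp add: not_frequently not_less)
    then have "limsup (\<lambda>n. ereal (f n)) \<le> ereal (1 - e)"
      by (rule Limsup_bounded)
    with L e show False
      by (simp add: one_ereal_def)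
  qed
next
  assume R: "\<forall>e>0. \<exists>\<^sub>F n in sequentially. 1 - e < f n"
  have "limsup (\<lambda>n. ereal (f n)) \<le> 1"
    by (rule Limsup_bounded) (use assms in \<open>auto simp: one_ereal_def\<close>)
  moreover have "\<not> limsup (\<lambda>n. ereal (f n)) < 1"
  proof
    assume "limsup (\<lambda>n. ereal (f n)) < 1"
    then obtain c where c: "limsup (\<lambda>n. ereal (f n)) < ereal c" "ereal c < 1"
      using ereal_dense2 by blast
    have "\<forall>\<^sub>F n in sequentially. f n < c"
      using Limsup_lessD[OF c(1)] by simp
    moreover have "\<exists>\<^sub>F n in sequentially. 1 - (1 - c) < f n"
      using R[rule_format, of "1 - c"] c(2) by (simp add: one_ereal_def)
    ultimately show False
      using frequently_eventually_frequently by (fastforce dest: frequently_ex)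
  qed
  ultimately show "limsup (\<lambda>n. ereal (f n)) = 1"
    by simp
qed

lemma liminf_eq_0_iff:
  fixes f :: "nat \<Rightarrow> real"
  assumes "\<And>n. 0 \<le> f n"
  shows "liminf (\<lambda>n. ereal (f n)) = 0 \<longleftrightarrow> (\<forall>e>0. \<exists>\<^sub>F n in sequentially. f n < e)"
proof (intro iffI allI impI)
  fix e :: real
  assume L: "liminf (\<lambda>n. ereal (f n)) = 0" and e: "0 < e"
  show "\<exists>\<^sub>F n in sequentially. f n < e"
  proof (rule ccontr)
    assume "\<not> (\<exists>\<^sub>F n in sequentially. f n < e)"
    then have "\<forall>\<^sub>F n in sequentially. ereal e \<le> ereal (f n)"
      by (simp add: not_frequently not_less)
    then have "ereal e \<le> liminf (\<lambda>n. ereal (f n))"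
      by (rule Liminf_bounded)
    with L e show False
      by (simp add: zero_ereal_def)
  qed
next
  assume R: "\<forall>e>0. \<exists>\<^sub>F n in sequentially. f n < e"
  have "0 \<le> liminf (\<lambda>n. ereal (f n))"
    by (rule Liminf_bounded) (use assms in \<open>auto simp: zero_ereal_def\<close>)
  moreover have "\<not> 0 < liminf (\<lambda>n. ereal (f n))"
  proof
    assume "0 < liminf (\<lambda>n. ereal (f n))"
    then obtain c where c: "0 < ereal c" "ereal c < liminf (\<lambda>n. ereal (f n))"
      using ereal_dense2 by blast
    have "\<forall>\<^sub>F n in sequentially. c < f n"
      using less_LiminfD[OF c(2)] by simp
    moreover have "\<exists>\<^sub>F n in sequentially. f n < c"
      using R c(1) by (simp add: zero_ereal_def)
    ultimately show False
      using frequently_eventually_frequently by (fastforce dest: frequently_ex)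
  qed
  ultimately show "liminf (\<lambda>n. ereal (f n)) = 0"
    by simp
qed

lemma card_filter_div_le_1: "real (card {n\<in>{1..N}. P n}) / real N \<le> 1"
proof -
  have "card {n\<in>{1..N}. P n} \<le> card {1..N}"
    by (intro card_mono) auto
  then have "real (card {n\<in>{1..N}. P n}) \<le> real N"
    by simp
  then show ?thesis
    by (cases "N = 0") (simp_all add: divide_le_eq_1)
qed

text \<open>\<open>frequently\<close> ignores the single index N = 0, where the quotient is a
  division by zero with default value 0.\<close>

lemma frequently_ratio_iff:
  assumes "\<And>N. 1 \<le> N \<Longrightarrow> Q (real (f N) / real N) \<longleftrightarrow> R N" "\<not> R 0"
  shows "(\<exists>\<^sub>F N in sequentially. Q (real (f N) / real N)) \<longleftrightarrow> (\<exists>\<^sub>F N in sequentially. R N)"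
  by (rule frequently_cong[OF eventually_ge_at_top[of 1]]) (use assms in auto)

lemma limsup_card_eq_1_iff:
  "limsup (\<lambda>N. ereal (real (card {n\<in>{1..N}. P n}) / real N)) = 1 \<longleftrightarrow> full_density P"
proof -
  have "(\<exists>\<^sub>F N in sequentially. 1 - e < real (card {n\<in>{1..N}. P n}) / real N) \<longleftrightarrow>
     (\<exists>\<^sub>F N in sequentially. (1 - e) * real N < real (card {n\<in>{1..N}. P n}))" for e
    by (rule frequently_ratio_iff) (auto simp: field_simps)
  then show ?thesis
    unfolding full_density_def limsup_eq_1_iff[OF card_filter_div_le_1] by simp
qed

lemma card_filter_compl:
  "real (card {n\<in>{1..N}. \<not> P n}) = real N - real (card {n\<in>{1..N}. P n})"
proof -
  have "card {n\<in>{1..N}. P n} + card {n\<in>{1..N}. \<not> P n} = card ({n\<in>{1..N}. P n} \<union> {n\<in>{1..N}. \<not> P n})"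
    by (rule card_Un_disjoint[symmetric]) auto
  also have "{n\<in>{1..N}. P n} \<union> {n\<in>{1..N}. \<not> P n} = {1..N}"
    by auto
  finally show ?thesis
    by simp
qed

text \<open>P has a small frequency exactly when its negation has a frequency close to 1, so both
  clauses of distributional chaos become statements about \<open>full_density\<close>.\<close>

lemma liminf_card_eq_0_iff:
  "liminf (\<lambda>N. ereal (real (card {n\<in>{1..N}. P n}) / real N)) = 0 \<longleftrightarrow> full_density (\<lambda>n. \<not> P n)"
proof -
  have "(\<exists>\<^sub>F N in sequentially. real (card {n\<in>{1..N}. P n}) / real N < e) \<longleftrightarrow>
     (\<exists>\<^sub>F N in sequentially. (1 - e) * real N < real (card {n\<in>{1..N}. \<not> P n}))" for e
    unfolding card_filter_compl by (rule frequently_ratio_iff) (auto simp: field_simps)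
  then show ?thesis
    unfolding full_density_def by (subst liminf_eq_0_iff) simp_all
qed

lemma upper_density_eq_1_iff: "upper_density A = 1 \<longleftrightarrow> full_density (\<lambda>n. n \<in> A)"
proof -
  have "{1..N} \<inter> A = {n\<in>{1..N}. n \<in> A}" for N
    by auto
  then show ?thesis
    unfolding upper_density_def by (simp only: limsup_card_eq_1_iff)
qed

text \<open>The \<open>P j\<close> need not be nested. D collects, for each K, the times up to
  \<open>M K\<close> at which \<open>P K\<close> holds: this block alone gives the required count at
  \<open>M K\<close>, and a member of D beyond all \<open>M K\<close> with K < j must come from a
  later block.\<close>

lemma full_density_diagonal:
  assumes "\<And>j::nat. full_density (\<lambda>n. P j n)"
  obtains D where "D \<subseteq> {1..}" "full_density (\<lambda>n. n \<in> D)"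
    "\<forall>j. \<exists>n0. \<forall>n\<in>D. n0 \<le> n \<longrightarrow> (\<exists>i\<ge>j. P i n)"
proof -
  have "\<exists>M\<ge>K. (1 - 1 / real K) * real M < real (card {n\<in>{1..M}. P K n})" if "1 \<le> K" for K
    using full_densityD[OF assms, of "1 / real K" K K] that by (metis divide_pos_pos of_nat_0_less_iff zero_less_one less_le_trans)
  then obtain M where M: "\<And>K. 1 \<le> K \<Longrightarrow> K \<le> M K"
    "\<And>K. 1 \<le> K \<Longrightarrow> (1 - 1 / real K) * real (M K) < real (card {n\<in>{1..M K}. P K n})"
    by metis
  define D where "D = (\<Union>K\<in>{1..}. {n\<in>{1..M K}. P K n})"
  have "full_density (\<lambda>n. n \<in> D)"
  proof (rule full_densityI)
    fix K :: nat assume K: "1 \<le> K"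
    have "card {n\<in>{1..M K}. P K n} \<le> card {n\<in>{1..M K}. n \<in> D}"
      by (rule card_mono) (use K in \<open>auto simp: D_def\<close>)
    then show "\<exists>N\<ge>K. (1 - 1 / real K) * real N < real (card {n \<in> {1..N}. n \<in> D})"
      using M[OF K] by (intro exI[of _ "M K"]) auto
  qed
  moreover have "\<exists>n0. \<forall>n\<in>D. n0 \<le> n \<longrightarrow> (\<exists>i\<ge>j. P i n)" for j
  proof (rule exI[of _ "Suc (\<Sum>K<j. M K)"], intro ballI impI)
    fix n assume n: "n \<in> D" "Suc (\<Sum>K<j. M K) \<le> n"
    then obtain K where K: "n \<le> M K" "P K n"
      by (auto simp: D_def)
    have "\<not> K < j"
    proof
      assume "K < j"
      then have "M K \<le> (\<Sum>K<j. M K)"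
        by (intro member_le_sum) auto
      with K n show False by simp
    qed
    with K show "\<exists>i\<ge>j. P i n" by (auto simp: not_less)
  qed
  ultimately show ?thesis
    using that[of D] by (auto simp: D_def)
qed

section \<open>Frechet spaces\<close>

lemma half_power_less:
  assumes "0 < (e::real)"
  obtains k where "1 \<le> k" "(1/2) ^ k < e"
proof -
  obtain k where "(1/2) ^ k < e"
    using real_arch_pow_inv[OF assms, of "1/2"] by auto
  moreover have "(1/2) ^ Suc k \<le> (1/2 :: real) ^ k"
    by (rule power_decreasing) auto
  ultimately have "(1/2) ^ Suc k < e"
    by linarith
  then show ?thesis
    using that[of "Suc k"] by (metis One_nat_def Suc_leI zero_less_Suc)
qed

context frechet_space
begin

sublocale Metric_space X "frechet_dist X p"
  by (rule metric)

lemma zero_in [simp]: "0 \<in> X"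
  and add_in [intro]: "x \<in> X \<Longrightarrow> y \<in> X \<Longrightarrow> x + y \<in> X"
  and scale_in [intro]: "x \<in> X \<Longrightarrow> smul c x \<in> X"
  and diff_in [intro]: "x \<in> X \<Longrightarrow> y \<in> X \<Longrightarrow> x - y \<in> X"
  using subspace_carrier by (auto intro: subspace_0 subspace_add subspace_scale subspace_diff)

lemma seminorm_onD:
  assumes "seminorm_on smul X q" "x \<in> X"
  shows seminorm_nonneg: "0 \<le> q x"
    and seminorm_scale: "q (smul c x) = norm c * q x"
    and seminorm_triangle: "y \<in> X \<Longrightarrow> q (x + y) \<le> q x + q y"
  using assms by (auto simp: seminorm_on_def)

lemma seminorm_zero:
  assumes "seminorm_on smul X q"
  shows "q 0 = 0"
  using seminorm_scale[OF assms zero_in, of 0] by simp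

lemma seminorm_minus:
  assumes "seminorm_on smul X q" "x \<in> X"
  shows "q (- x) = q x"
  using seminorm_scale[OF assms, of "- 1"] by simp

lemma seminorm_diff_commute:
  assumes "seminorm_on smul X q" "x \<in> X" "y \<in> X"
  shows "q (x - y) = q (y - x)"
  using seminorm_minus[OF assms(1) diff_in[OF assms(2,3)]] by simp

lemma seminorm_diff_triangle:
  assumes "seminorm_on smul X q" "x \<in> X" "y \<in> X"
  shows "q (x - y) \<le> q x + q y"
proof -
  have "q (x + smul (- 1) y) \<le> q x + q (smul (- 1) y)"
    by (intro seminorm_triangle assms scale_in)
  then show ?thesis
    using seminorm_scale[OF assms(1,3), of "- 1"] by simp
qed

lemma seminorm_le_add_diff:
  assumes "seminorm_on smul X q" "x \<in> X" "y \<in> X"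
  shows "q x \<le> q y + q (x - y)"
  using seminorm_triangle[OF assms(1,3) diff_in[OF assms(2,3)]] by simp

lemma seminorm_le_add_plus:
  assumes "seminorm_on smul X q" "x \<in> X" "y \<in> X"
  shows "q x \<le> q (x + y) + q y"
  using seminorm_diff_triangle[OF assms(1) add_in[OF assms(2,3)] assms(3)] by simp

section \<open>The metric compared with the seminorms\<close>

lemma frechet_dist_summable:
  assumes "x \<in> X" "y \<in> X"
  shows "summable (\<lambda>k. (1/2) ^ Suc k * min 1 (p (Suc k) (x - y)))"
proof (rule summable_comparison_test')
  show "summable (\<lambda>k. (1/2) ^ Suc k :: real)"
    by (subst summable_Suc_iff) (rule summable_geometric, simp)
  fix k
  have "0 \<le> p (Suc k) (x - y)"
    using assms by (intro seminorm_nonneg[OF seminorms]) auto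
  then show "norm ((1/2) ^ Suc k * min 1 (p (Suc k) (x - y))) \<le> (1/2) ^ Suc k"
    by (simp add: abs_mult min_def)
qed

lemma frechet_dist_ge:
  assumes "x \<in> X" "y \<in> X" "1 \<le> k"
  shows "(1/2) ^ k * min 1 (p k (x - y)) \<le> frechet_dist X p x y"
proof -
  define f where "f = (\<lambda>k. (1/2) ^ Suc k * min 1 (p (Suc k) (x - y)))"
  have "0 \<le> p (Suc k) (x - y)" for k
    using assms by (intro seminorm_nonneg[OF seminorms]) auto
  \<comment> \<open>Summand number k - 1 is the one that carries the seminorm
    \<open>p k\<close>.\<close>
  then have "sum f {k - 1} \<le> suminf f"
    using frechet_dist_summable[OF assms(1,2)]
    by (intro sum_le_suminf) (auto simp: f_def)
  moreover have "sum f {k - 1} = (1/2) ^ k * min 1 (p k (x - y))"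
    using assms(3) by (cases k) (simp_all add: f_def)
  moreover have "frechet_dist X p x y = suminf f"
    using assms by (simp add: f_def frechet_dist_def)
  ultimately show ?thesis
    by linarith
qed

text \<open>Each of the first k summands is at most its weight times \<open>p k (x - y)\<close>,
  because the seminorms increase, and these weights add up to at most 1. The remaining summands are
  bounded by their weights, whose sum is (1/2)^k.\<close>

lemma frechet_dist_le:
  assumes "x \<in> X" "y \<in> X" "1 \<le> k"
  shows "frechet_dist X p x y \<le> p k (x - y) + (1/2) ^ k"
proof -
  define f where "f = (\<lambda>k. (1/2) ^ Suc k * min 1 (p (Suc k) (x - y)))"
  have xy: "x - y \<in> X"
    using assms by auto
  have nn: "0 \<le> p (Suc k) (x - y)" for k
    using seminorm_nonneg[OF seminorms xy] by simp
  have sf: "summable f"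
    using frechet_dist_summable[OF assms(1,2)] by (simp add: f_def)
  have geo: "(\<lambda>n. (1/2) ^ Suc n) sums (1::real)"
    using power_half_series .
  have "(\<Sum>n<k. f n) \<le> (\<Sum>n<k. (1/2) ^ Suc n * p k (x - y))"
  proof (rule sum_mono)
    fix n assume n: "n \<in> {..<k}"
    have "min 1 (p (Suc n) (x - y)) \<le> p k (x - y)"
      using seminorms_mono[of "Suc n" k "x - y"] n xy by auto
    then show "f n \<le> (1/2) ^ Suc n * p k (x - y)"
      unfolding f_def by (intro mult_left_mono) auto
  qed
  also have "\<dots> = (\<Sum>n<k. (1/2) ^ Suc n) * p k (x - y)"
    by (simp only: sum_distrib_right)
  also have "\<dots> \<le> 1 * p k (x - y)"
  proof (rule mult_right_mono)
    have "(\<Sum>n<k. (1/2) ^ Suc n) \<le> suminf (\<lambda>n. (1/2) ^ Suc n :: real)"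
      using geo by (intro sum_le_suminf) (auto dest: sums_summable)
    then show "(\<Sum>n<k. (1/2) ^ Suc n) \<le> (1::real)"
      using geo by (simp add: sums_iff)
    show "0 \<le> p k (x - y)"
      using seminorm_nonneg[OF seminorms xy] assms by simp
  qed
  finally have 1: "(\<Sum>n<k. f n) \<le> p k (x - y)"
    by simp
  have "suminf (\<lambda>n. f (n + k)) \<le> suminf (\<lambda>n. (1/2) ^ k * (1/2) ^ Suc n)"
  proof (rule suminf_le)
    show "f (n + k) \<le> (1/2) ^ k * (1/2) ^ Suc n" for n
      using nn[of "n + k"] by (simp add: f_def power_add)
    show "summable (\<lambda>n. f (n + k))"
      using sf by (rule summable_ignore_initial_segment)
    show "summable (\<lambda>n. (1/2) ^ k * (1/2) ^ Suc n :: real)"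
      using geo by (intro summable_mult) (auto dest: sums_summable)
  qed
  also have "\<dots> = (1/2) ^ k"
    using geo by (subst suminf_mult) (auto simp: sums_iff)
  finally have 2: "suminf (\<lambda>n. f (n + k)) \<le> (1/2) ^ k" .
  have "frechet_dist X p x y = suminf f"
    using assms by (simp add: frechet_dist_def f_def)
  also have "\<dots> = suminf (\<lambda>n. f (n + k)) + (\<Sum>n<k. f n)"
    by (rule suminf_split_initial_segment[OF sf])
  finally show ?thesis
    using 1 2 by simp
qed

lemma frechet_dist_translate:
  assumes "x \<in> X" "y \<in> X"
  shows "frechet_dist X p x y = frechet_dist X p (x - y) 0"
  using assms by (auto simp: frechet_dist_def)

lemma ball_subset_mball:
  assumes "x \<in> X" "0 < r"
  obtains k e where "1 \<le> k" "0 < e" "\<And>y. y \<in> X \<Longrightarrow> p k (y - x) < e \<Longrightarrow> y \<in> mball x r"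
proof -
  obtain k where k: "1 \<le> k" "(1/2) ^ k < r / 2"
    using half_power_less[of "r/2"] assms by auto
  have "y \<in> mball x r" if "y \<in> X" "p k (y - x) < r / 2" for y
  proof -
    have "frechet_dist X p y x < r"
      using frechet_dist_le[OF that(1) assms(1) k(1)] that(2) k(2) by linarith
    then show ?thesis
      using assms that by (simp add: commute)
  qed
  with k that[of k "r/2"] assms show ?thesis by simp
qed

lemma seminorm_small_of_mball:
  assumes "x \<in> X" "1 \<le> k" "0 < e"
  obtains r where "0 < r" "\<And>y. y \<in> mball x r \<Longrightarrow> p k (y - x) < e"
proof
  \<comment> \<open>The metric sees only the seminorm cut off at 1. Capping e at 1 forces the
    cut-off value below 1, so that it is the seminorm itself.\<close>
  show "0 < (1/2) ^ k * min 1 e"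
    using assms by simp
  fix y assume y: "y \<in> mball x ((1/2) ^ k * min 1 e)"
  then have yX: "y \<in> X"
    by simp
  have "frechet_dist X p y x < (1/2) ^ k * min 1 e"
    using y by (simp add: commute)
  then have "(1/2) ^ k * min 1 (p k (y - x)) < (1/2) ^ k * min 1 e"
    using frechet_dist_ge[OF yX assms(1,2)] by linarith
  then show "p k (y - x) < e"
    by (auto simp: min_def split: if_splits)
qed

text \<open>Since the seminorms increase, balls of a single seminorm form a neighbourhood base,
  without finite intersections.\<close>

lemma frechet_open_iff:
  "openin mtopology U \<longleftrightarrow> U \<subseteq> X \<and> (\<forall>x\<in>U. \<exists>k\<ge>1. \<exists>e>0. \<forall>y\<in>X. p k (y - x) < e \<longrightarrow> y \<in> U)"
proof (intro iffI conjI ballI)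
  assume U: "openin mtopology U"
  then show "U \<subseteq> X"
    by (simp add: openin_mtopology)
  fix x assume x: "x \<in> U"
  then obtain r where r: "r > 0" "mball x r \<subseteq> U"
    using U by (auto simp: openin_mtopology)
  obtain k e where "1 \<le> k" "0 < e" "\<And>y. y \<in> X \<Longrightarrow> p k (y - x) < e \<Longrightarrow> y \<in> mball x r"
    using ball_subset_mball[of x r] \<open>U \<subseteq> X\<close> x r(1) by blast
  with r show "\<exists>k\<ge>1. \<exists>e>0. \<forall>y\<in>X. p k (y - x) < e \<longrightarrow> y \<in> U"
    by blast
next
  assume U: "U \<subseteq> X \<and> (\<forall>x\<in>U. \<exists>k\<ge>1. \<exists>e>0. \<forall>y\<in>X. p k (y - x) < e \<longrightarrow> y \<in> U)"
  show "openin mtopology U"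
    unfolding openin_mtopology
  proof (intro conjI allI impI)
    fix x assume x: "x \<in> U"
    then obtain k e where ke: "1 \<le> k" "0 < e" "\<forall>y\<in>X. p k (y - x) < e \<longrightarrow> y \<in> U"
      using U by blast
    obtain r where "0 < r" "\<And>y. y \<in> mball x r \<Longrightarrow> p k (y - x) < e"
      using seminorm_small_of_mball[of x k e] U x ke by blast
    with ke show "\<exists>r>0. mball x r \<subseteq> U"
      by (intro exI[of _ r]) (auto simp del: in_mball, meson in_mball)
  qed (use U in blast)
qed

lemma frechet_limitin_iff:
  "limitin mtopology f l F \<longleftrightarrow>
     l \<in> X \<and> (\<forall>k\<ge>1. \<forall>e>0. \<forall>\<^sub>F n in F. f n \<in> X \<and> p k (f n - l) < e)"
proof (intro iffI conjI allI impI)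
  assume L: "limitin mtopology f l F"
  then show l: "l \<in> X"
    by (auto simp: limitin_def)
  fix k :: nat and e :: real
  assume "1 \<le> k" "0 < e"
  then obtain r where r: "0 < r" "\<And>y. y \<in> mball l r \<Longrightarrow> p k (y - l) < e"
    using seminorm_small_of_mball[OF l] by blast
  have "\<forall>\<^sub>F n in F. f n \<in> mball l r"
    by (rule limitinD[OF L openin_mball]) (use l r in simp)
  then show "\<forall>\<^sub>F n in F. f n \<in> X \<and> p k (f n - l) < e"
    by eventually_elim (use r in auto)
next
  assume R: "l \<in> X \<and> (\<forall>k\<ge>1. \<forall>e>0. \<forall>\<^sub>F n in F. f n \<in> X \<and> p k (f n - l) < e)"
  show "limitin mtopology f l F"
    unfolding limitin_def
  proof (intro conjI allI impI)
    fix U assume U: "openin mtopology U \<and> l \<in> U"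
    then obtain k e where "1 \<le> k" "0 < e" and *: "\<forall>y\<in>X. p k (y - l) < e \<longrightarrow> y \<in> U"
      unfolding frechet_open_iff by blast
    with R have "\<forall>\<^sub>F n in F. f n \<in> X \<and> p k (f n - l) < e"
      by blast
    then show "\<forall>\<^sub>F n in F. f n \<in> U"
      by eventually_elim (use * in auto)
  qed (use R in simp)
qed

text \<open>Scaling x into the ball of radius e gives the bound. As \<open>p k x\<close> may be 0,
  the scaling uses an arbitrary s > \<open>p k x\<close>, and s then decreases to
  \<open>p k x\<close>.\<close>

lemma seminorm_bound:
  assumes q: "seminorm_on smul X q" and k: "1 \<le> k" and e: "0 < e"
    and B: "\<And>x. x \<in> X \<Longrightarrow> p k x < e \<Longrightarrow> q x \<le> B" and x: "x \<in> X"
  shows "q x \<le> B / e * p k x"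
proof -
  have B0: "0 \<le> B"
    using B[of 0] e seminorm_zero[OF q] seminorm_zero[OF seminorms[OF k]] by simp
  have px: "0 \<le> p k x"
    by (rule seminorm_nonneg[OF seminorms[OF k] x])
  have *: "q x \<le> B / e * s" if "p k x < s" for s
  proof -
    have s: "0 < s"
      using px that by simp
    define c :: 'k where "c = of_real (e / s)"
    have c: "norm c = e / s"
      using e s by (simp add: c_def norm_of_real del: of_real_divide)
    have "p k (smul c x) < e"
      using s e that by (simp add: seminorm_scale[OF seminorms[OF k] x] c field_simps)
    then have "q (smul c x) \<le> B"
      using x by (intro B) auto
    then show ?thesis
      using s e by (simp add: seminorm_scale[OF q x] c field_simps)
  qed
  show ?thesis
  \<comment> \<open>The other case divides by B / e; for B = 0 any admissible s already gives the
    bound.\<close>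
  proof (cases "B = 0")
    case True
    then show ?thesis
      using *[of "p k x + 1"] by simp
  next
    case False
    with B0 e have Be: "0 < B / e"
      by simp
    show ?thesis
    proof (rule field_le_epsilon)
      fix d :: real assume d: "0 < d"
      have "q x \<le> B / e * (p k x + d / (B / e))"
        using Be d by (intro *) (simp only: less_add_same_cancel1 divide_pos_pos)
      also have "\<dots> = B / e * p k x + d"
        using Be e \<open>B \<noteq> 0\<close> by (simp add: distrib_left)
      finally show "q x \<le> B / e * p k x + d" .
    qed
  qed
qed

section \<open>Continuous seminorms and uniform boundedness\<close>

definition continuous_seminorm :: "('a \<Rightarrow> real) \<Rightarrow> bool" where
  "continuous_seminorm q \<longleftrightarrow>
     seminorm_on smul X q \<and> (\<exists>k\<ge>1. \<exists>C>0. \<forall>x\<in>X. q x \<le> C * p k x)"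

lemma continuous_seminormI:
  assumes q: "seminorm_on smul X q" and "1 \<le> k" "0 < e"
    and B: "\<And>x. x \<in> X \<Longrightarrow> p k x < e \<Longrightarrow> q x \<le> B"
  shows "continuous_seminorm q"
  unfolding continuous_seminorm_def
\<comment> \<open>The definition asks for a positive constant while B may be 0, hence \<bar>B\<bar>
  + 1.\<close>
proof (intro conjI q exI[of _ k] exI[of _ "(\<bar>B\<bar> + 1) / e"] ballI)
  have B': "q x \<le> \<bar>B\<bar> + 1" if "x \<in> X" "p k x < e" for x
    using B[OF that] by linarith
  show "q x \<le> (\<bar>B\<bar> + 1) / e * p k x" if "x \<in> X" for x
    by (rule seminorm_bound) (use assms B' that in auto)
qed (use assms in auto)

lemma continuous_seminorm_p: "1 \<le> k \<Longrightarrow> continuous_seminorm (p k)"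
  unfolding continuous_seminorm_def by (intro conjI seminorms exI[of _ k] exI[of _ 1]) auto

lemma continuous_seminormD:
  assumes "continuous_seminorm q"
  shows "seminorm_on smul X q"
    and "0 < e \<Longrightarrow> \<exists>k\<ge>1. \<exists>d>0. \<forall>x\<in>X. p k x < d \<longrightarrow> q x < e"
proof -
  show "seminorm_on smul X q"
    using assms by (simp add: continuous_seminorm_def)
  assume e: "0 < e"
  obtain k C where "1 \<le> k" "C > 0" and C: "\<forall>x\<in>X. q x \<le> C * p k x"
    using assms by (auto simp: continuous_seminorm_def)
  have "q x < e" if "x \<in> X" "p k x < e / C" for x
  proof -
    have "q x \<le> C * p k x"
      using C that by blast
    also have "\<dots> < e"
      using that \<open>C > 0\<close> by (simp add: field_simps)
    finally show ?thesis .
  qed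
  with \<open>1 \<le> k\<close> \<open>C > 0\<close> e show "\<exists>k\<ge>1. \<exists>d>0. \<forall>x\<in>X. p k x < d \<longrightarrow> q x < e"
    by (intro exI[of _ k] conjI exI[of _ "e / C"]) auto
qed

lemma openin_seminorm_less:
  assumes "continuous_seminorm q"
  shows "openin mtopology {x\<in>X. q x < r}"
  unfolding frechet_open_iff
proof (intro conjI ballI)
  note q = continuous_seminormD(1)[OF assms]
  fix x assume x: "x \<in> {x\<in>X. q x < r}"
  then obtain k d where kd: "k \<ge> 1" "d > 0" "\<forall>x'\<in>X. p k x' < d \<longrightarrow> q x' < r - q x"
    using continuous_seminormD(2)[OF assms, of "r - q x"] by auto
  have "q y < r" if "y \<in> X" "p k (y - x) < d" for y
  proof -
    have "q (y - x) < r - q x"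
      using kd that x by auto
    then show ?thesis
      using seminorm_le_add_diff[OF q, of y x] that x by auto
  qed
  with kd show "\<exists>k\<ge>1. \<exists>e>0. \<forall>y\<in>X. p k (y - x) < e \<longrightarrow> y \<in> {x\<in>X. q x < r}"
    by (intro exI[of _ k] conjI exI[of _ d]) auto
qed auto

lemma openin_seminorm_greater:
  assumes "continuous_seminorm q"
  shows "openin mtopology {x\<in>X. r < q x}"
  unfolding frechet_open_iff
proof (intro conjI ballI)
  note q = continuous_seminormD(1)[OF assms]
  fix x assume x: "x \<in> {x\<in>X. r < q x}"
  then obtain k d where kd: "k \<ge> 1" "d > 0" "\<forall>x'\<in>X. p k x' < d \<longrightarrow> q x' < q x - r"
    using continuous_seminormD(2)[OF assms, of "q x - r"] by auto
  have "r < q y" if "y \<in> X" "p k (y - x) < d" for y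
  proof -
    have "q (y - x) < q x - r"
      using kd that x by auto
    then show ?thesis
      using seminorm_le_add_diff[OF q, of x y] seminorm_diff_commute[OF q, of x y] that x by auto
  qed
  with kd show "\<exists>k\<ge>1. \<exists>e>0. \<forall>y\<in>X. p k (y - x) < e \<longrightarrow> y \<in> {x\<in>X. r < q x}"
    by (intro exI[of _ k] conjI exI[of _ d]) auto
qed auto

text \<open>The Banach-Steinhaus argument for seminorms: by Baire one of the closed sets
  \<open>A R\<close> contains a ball around some x0. Moving it to the origin costs another
  \<open>q i x0\<close> \<le> R, which gives the bound 2 R on a ball around 0 for all i at
  once.\<close>

lemma uniform_boundedness:
  fixes q :: "'i \<Rightarrow> 'a \<Rightarrow> real"
  assumes q: "\<And>i. continuous_seminorm (q i)"
    and bdd: "\<And>x. x \<in> X \<Longrightarrow> \<exists>R. \<forall>i. q i x \<le> R"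
  obtains k C where "1 \<le> k" "\<And>i x. x \<in> X \<Longrightarrow> q i x \<le> C * p k x"
proof -
  define A where "A = (\<lambda>R::nat. {x\<in>X. \<forall>i. q i x \<le> real R})"
  have closed: "closedin mtopology (A R)" for R
  proof -
    have "A R = X - (\<Union>i. {x\<in>X. real R < q i x})"
      by (auto simp: A_def not_less) (use leD in blast)
    moreover have "openin mtopology (\<Union>i. {x\<in>X. real R < q i x})"
      using openin_seminorm_greater[OF q] by blast
    ultimately show ?thesis
      by (auto simp: closedin_def Diff_Diff_Int Int_absorb1)
  qed
  have "\<Union> (range A) = X"
  proof (intro equalityI subsetI)
    fix x assume x: "x \<in> X"
    then obtain R where R: "\<forall>i. q i x \<le> R"
      using bdd by blast
    obtain n where "R \<le> real n"
      using real_arch_simple by blast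
    with R x have "x \<in> A n"
      by (auto simp: A_def intro: order_trans)
    then show "x \<in> \<Union> (range A)"
      by blast
  qed (auto simp: A_def)
  then have "mtopology interior_of \<Union> (range A) = X"
    by (metis interior_of_topspace topspace_mtopology)
  then have "mtopology interior_of \<Union> (range A) \<noteq> {}"
    using zero_in by blast
  then obtain R where "mtopology interior_of (A R) \<noteq> {}"
    using metric_Baire_category_alt[OF complete, of "range A"] closed by auto
  then obtain x0 U where U: "openin mtopology U" "x0 \<in> U" "U \<subseteq> A R"
    by (auto simp: interior_of_def)
  then obtain k e where ke: "1 \<le> k" "0 < e" "\<forall>y\<in>X. p k (y - x0) < e \<longrightarrow> y \<in> U"
    unfolding frechet_open_iff by blast
  have x0: "x0 \<in> X" "\<And>i. q i x0 \<le> R"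
    using U by (auto simp: A_def)
  have "q i x \<le> 2 * real R" if x: "x \<in> X" "p k x < e" for i x
  proof -
    have "x0 + x \<in> U"
      using ke(3)[rule_format, of "x0 + x"] x x0(1) add_in by force
    then have "q i (x0 + x) \<le> R"
      using U by (auto simp: A_def)
    moreover have "q i x \<le> q i (x + x0) + q i x0"
      by (rule seminorm_le_add_plus[OF continuous_seminormD(1)[OF q] x(1) x0(1)])
    ultimately show ?thesis
      using x0(2)[of i] by (simp add: add.commute)
  qed
  then show ?thesis
    by (intro that[OF ke(1), of "2 * real R / e"] seminorm_bound[OF continuous_seminormD(1)[OF q] ke(1,2)])
qed

end

section \<open>Distributional chaos of continuous linear operators\<close>

text \<open>For fixed N, the finitely many open conditions that hold at x persist on a
  neighbourhood, so the count cannot drop there.\<close>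

lemma openin_card_greater:
  assumes "\<And>n::nat. openin Z {x\<in>topspace Z. P x n}"
  shows "openin Z {x\<in>topspace Z. \<exists>N\<ge>K. c * real N < real (card {n\<in>{1..N}. P x n})}"
  (is "openin Z ?S")
proof (subst openin_subopen, intro ballI)
  fix x assume "x \<in> ?S"
  then obtain N where x: "x \<in> topspace Z"
    and N: "K \<le> N" "c * real N < real (card {n\<in>{1..N}. P x n})"
    by blast
  \<comment> \<open>The inserted \<open>topspace Z\<close> matters if no time qualifies: the
    intersection of the empty family is \<open>UNIV\<close>.\<close>
  define W where
    "W = \<Inter> (insert (topspace Z) ((\<lambda>n. {x\<in>topspace Z. P x n}) ` {n\<in>{1..N}. P x n}))"
  have "openin Z W"
    unfolding W_def by (rule openin_Inter) (use assms in auto)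
  moreover have "x \<in> W"
    using x by (auto simp: W_def)
  moreover have "W \<subseteq> ?S"
  proof
    fix y assume y: "y \<in> W"
    have "card {n\<in>{1..N}. P x n} \<le> card {n\<in>{1..N}. P y n}"
      by (rule card_mono) (use y in \<open>auto simp: W_def\<close>)
    with N(2) have "c * real N < real (card {n\<in>{1..N}. P y n})"
      by linarith
    with N(1) y show "y \<in> ?S"
      by (auto simp: W_def)
  qed
  ultimately show "\<exists>T. openin Z T \<and> x \<in> T \<and> T \<subseteq> ?S"
    by blast
qed

lemma Baire_sequence:
  assumes "completely_metrizable_space Z" "topspace Z \<noteq> {}"
    and "\<And>n::nat. openin Z (U n)" "\<And>n. Z closure_of (U n) = topspace Z"
  obtains x where "x \<in> topspace Z" "\<And>n. x \<in> U n"
proof -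
  have "Z closure_of \<Inter> (range U) = topspace Z"
    by (rule Baire_category) (use assms in auto)
  then have "\<Inter> (range U) \<noteq> {}"
    using assms(2) by force
  then obtain x where x: "\<And>n. x \<in> U n"
    by auto
  moreover have "x \<in> topspace Z"
    using x[of 0] openin_subset[OF assms(3)[of 0]] by blast
  ultimately show ?thesis
    using that by blast
qed

section \<open>Iterates of a continuous linear operator\<close>

locale frechet_operator = frechet_space smul X p
  for smul :: "'k::{real_normed_field,banach} \<Rightarrow> 'a::ab_group_add \<Rightarrow> 'a" and X p +
  fixes T :: "'a \<Rightarrow> 'a"
  assumes maps_in: "x \<in> X \<Longrightarrow> T x \<in> X"
    and map_add: "x \<in> X \<Longrightarrow> y \<in> X \<Longrightarrow> T (x + y) = T x + T y"
    and map_scale: "x \<in> X \<Longrightarrow> T (smul c x) = smul c (T x)"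
    and continuous: "continuous_map (frechet_topology X p) (frechet_topology X p) T"
begin

lemma funpow_in [intro]: "x \<in> X \<Longrightarrow> (T ^^ n) x \<in> X"
  by (induction n) (auto intro: maps_in)

lemma funpow_map_add: "x \<in> X \<Longrightarrow> y \<in> X \<Longrightarrow> (T ^^ n) (x + y) = (T ^^ n) x + (T ^^ n) y"
  by (induction n) (auto simp: map_add funpow_in)

lemma funpow_map_scale: "x \<in> X \<Longrightarrow> (T ^^ n) (smul c x) = smul c ((T ^^ n) x)"
  by (induction n) (auto simp: map_scale funpow_in)

lemma funpow_map_diff:
  assumes "x \<in> X" "y \<in> X"
  shows "(T ^^ n) (x - y) = (T ^^ n) x - (T ^^ n) y"
  using funpow_map_add[OF diff_in[OF assms] assms(2), of n] by (simp add: eq_diff_eq)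

lemma funpow_map_zero: "(T ^^ n) 0 = 0"
  using funpow_map_diff[of 0 0 n] by simp

lemma funpow_map_sum:
  assumes "finite A" "\<And>i. i \<in> A \<Longrightarrow> f i \<in> X"
  shows "(T ^^ n) (sum f A) = (\<Sum>i\<in>A. (T ^^ n) (f i))"
  using assms
proof (induction A rule: finite_induct)
  case (insert a A)
  then show ?case
    by (simp add: funpow_map_add subspace_sum[OF subspace_carrier])
qed (simp add: funpow_map_zero)

lemma continuous_seminorm_comp:
  assumes "continuous_seminorm q"
  shows "continuous_seminorm (\<lambda>x. q (T x))"
proof -
  note q = continuous_seminormD(1)[OF assms]
  have T0: "T 0 = 0"
    using funpow_map_zero[of 1] by simp
  have sT: "seminorm_on smul X (\<lambda>x. q (T x))"
    unfolding seminorm_on_def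
    by (simp add: maps_in map_add map_scale seminorm_nonneg[OF q] seminorm_scale[OF q]
        seminorm_triangle[OF q])
  have "openin mtopology {x\<in>X. T x \<in> {x\<in>X. q x < 1}}"
    using openin_continuous_map_preimage[OF continuous openin_seminorm_less[OF assms, of 1]] by simp
  moreover have "0 \<in> {x\<in>X. T x \<in> {x\<in>X. q x < 1}}"
    using T0 seminorm_zero[OF q] by simp
  ultimately obtain k e where "1 \<le> k" "0 < e"
    "\<forall>y\<in>X. p k (y - 0) < e \<longrightarrow> y \<in> {x\<in>X. T x \<in> {x\<in>X. q x < 1}}"
    unfolding frechet_open_iff by blast
  with sT show ?thesis
    by (intro continuous_seminormI[where k = k and e = e and B = 1]) auto
qed

lemma continuous_seminorm_funpow:
  "continuous_seminorm q \<Longrightarrow> continuous_seminorm (\<lambda>x. q ((T ^^ n) x))"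
proof (induction n arbitrary: q)
  case (Suc n)
  from Suc.IH[OF continuous_seminorm_comp[OF Suc.prems]] show ?case by simp
qed simp

text \<open>Finitely many iterates are controlled at once by the largest seminorm index and the
  smallest radius. The bound K allows the index to be pushed above a prescribed one.\<close>

lemma funpow_small:
  assumes "1 \<le> m" "0 < e"
  obtains k d where "K \<le> k" "1 \<le> k" "0 < d"
    "\<And>n x. n \<le> N \<Longrightarrow> x \<in> X \<Longrightarrow> p k x < d \<Longrightarrow> p m ((T ^^ n) x) < e"
proof -
  have "\<exists>k\<ge>1. \<exists>d>0. \<forall>x\<in>X. p k x < d \<longrightarrow> p m ((T ^^ n) x) < e" for n
    by (rule continuous_seminormD(2)[OF continuous_seminorm_funpow[OF continuous_seminorm_p[OF assms(1)]] assms(2)])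
  then obtain k d where kd: "\<And>n. 1 \<le> k n" "\<And>n. 0 < d n"
    "\<And>n x. x \<in> X \<Longrightarrow> p (k n) x < d n \<Longrightarrow> p m ((T ^^ n) x) < e"
    by metis
  define k' where "k' = Max (insert K (k ` {..N}))"
  define d' where "d' = Min (d ` {..N})"
  have k': "K \<le> k'" "\<And>n. n \<le> N \<Longrightarrow> k n \<le> k'"
    unfolding k'_def by (intro Max_ge; simp)+
  have d': "0 < d'" "\<And>n. n \<le> N \<Longrightarrow> d' \<le> d n"
    using kd(2) by (auto simp: d'_def)
  show ?thesis
  proof (rule that[OF k'(1) _ d'(1)])
    show "1 \<le> k'"
      using kd(1)[of 0] k'(2)[of 0] by simp
    fix n x assume n: "n \<le> N" and x: "x \<in> X" "p k' x < d'"
    have "p (k n) x \<le> p k' x"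
      using seminorms_mono[OF kd(1) k'(2)[OF n] x(1)] .
    with x(2) d'(2)[OF n] show "p m ((T ^^ n) x) < e"
      by (intro kd(3) x(1)) linarith
  qed
qed

text \<open>The orbits of s u and t u differ by (s - t) T^n u. As \<bar>s - t\<bar> can be
  arbitrarily small while \<epsilon> must not depend on the pair, the orbit of u has to exceed every
  R.\<close>

lemma distributionally_chaoticI:
  assumes u: "u \<in> X" and m: "1 \<le> m"
    and small: "\<And>k e. 1 \<le> k \<Longrightarrow> 0 < e \<Longrightarrow> full_density (\<lambda>n. p k ((T ^^ n) u) < e)"
    and big: "\<And>R. full_density (\<lambda>n. R < p m ((T ^^ n) u))"
  shows "distributionally_chaotic X (frechet_dist X p) T"
proof -
  define f where "f = (\<lambda>t::real. smul (of_real t) u)"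
  have fX: "f t \<in> X" for t
    using u by (auto simp: f_def)
  have "u \<noteq> 0"
  proof
    assume "u = 0"
    then obtain n where "0 < p m ((T ^^ n) 0)"
      using full_density_infinite[OF big[of 0]] by auto
    then show False
      using seminorm_zero[OF seminorms[OF m]] by (simp add: funpow_map_zero)
  qed
  then have "inj f"
    by (auto simp: inj_def f_def scale_cancel_right)
  then have "uncountable (range f)"
    using countable_image_inj_on uncountable_UNIV_real by blast
  moreover have "\<forall>x\<in>range f. \<forall>y\<in>range f. x \<noteq> y \<longrightarrow>
      liminf (\<lambda>k. ereal (real (card {n\<in>{1..k}.
        frechet_dist X p ((T ^^ n) x) ((T ^^ n) y) < (1/2) ^ m}) / real k)) = 0 \<and>
      (\<forall>\<tau>>0. limsup (\<lambda>k. ereal (real (card {n\<in>{1..k}.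
        frechet_dist X p ((T ^^ n) x) ((T ^^ n) y) < \<tau>}) / real k)) = 1)"
  proof (intro ballI impI)
    fix x y
    assume "x \<in> range f" "y \<in> range f" "x \<noteq> y"
    then obtain s t where [simp]: "x = f s" "y = f t" and "f s \<noteq> f t"
      by blast
    define c where "c = \<bar>s - t\<bar>"
    have c: "0 < c"
      using \<open>f s \<noteq> f t\<close> by (auto simp: c_def)
    have pk: "p k ((T ^^ n) (f s) - (T ^^ n) (f t)) = c * p k ((T ^^ n) u)" if "1 \<le> k" for k n
    proof -
      have "(T ^^ n) (f s) - (T ^^ n) (f t) = smul (of_real (s - t)) ((T ^^ n) u)"
        using u by (simp add: f_def funpow_map_scale scale_left_diff_distrib)
      then show ?thesis
        using u by (simp add: seminorm_scale[OF seminorms[OF that] funpow_in] c_def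
            del: of_real_diff)
    qed
    \<comment> \<open>A difference above 1 in \<open>p m\<close> contributes the full weight (1/2)^m
      to the metric; this is where \<epsilon> comes from.\<close>
    have "liminf (\<lambda>k. ereal (real (card {n\<in>{1..k}.
        frechet_dist X p ((T ^^ n) x) ((T ^^ n) y) < (1/2) ^ m}) / real k)) = 0"
      unfolding liminf_card_eq_0_iff
    proof (rule full_density_mono[OF big[of "1 / c"]])
      fix n assume "1 / c < p m ((T ^^ n) u)"
      then have "1 < p m ((T ^^ n) (f s) - (T ^^ n) (f t))"
        using c by (simp add: pk[OF m] field_simps)
      then show "\<not> frechet_dist X p ((T ^^ n) x) ((T ^^ n) y) < (1/2) ^ m"
        using frechet_dist_ge[OF funpow_in[OF fX] funpow_in[OF fX] m, of n s n t] by simp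
    qed
    moreover have "limsup (\<lambda>k. ereal (real (card {n\<in>{1..k}.
        frechet_dist X p ((T ^^ n) x) ((T ^^ n) y) < \<tau>}) / real k)) = 1" if \<tau>: "0 < \<tau>" for \<tau>
      unfolding limsup_card_eq_1_iff
    proof -
      obtain k where k: "1 \<le> k" "(1/2) ^ k < \<tau> / 2"
        using half_power_less[of "\<tau> / 2"] \<tau> by auto
      show "full_density (\<lambda>n. frechet_dist X p ((T ^^ n) x) ((T ^^ n) y) < \<tau>)"
      proof (rule full_density_mono[OF small[OF k(1)]])
        show "0 < \<tau> / (2 * c)"
          using \<tau> c by simp
        fix n assume "p k ((T ^^ n) u) < \<tau> / (2 * c)"
        then have "p k ((T ^^ n) (f s) - (T ^^ n) (f t)) < \<tau> / 2"
          using c by (simp add: pk[OF k(1)] field_simps)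
        then show "frechet_dist X p ((T ^^ n) x) ((T ^^ n) y) < \<tau>"
          using frechet_dist_le[OF funpow_in[OF fX] funpow_in[OF fX] k(1), of n s n t] k(2)
          by simp
      qed
    qed
    ultimately show "liminf (\<lambda>k. ereal (real (card {n\<in>{1..k}.
        frechet_dist X p ((T ^^ n) x) ((T ^^ n) y) < (1/2) ^ m}) / real k)) = 0 \<and>
      (\<forall>\<tau>>0. limsup (\<lambda>k. ereal (real (card {n\<in>{1..k}.
        frechet_dist X p ((T ^^ n) x) ((T ^^ n) y) < \<tau>}) / real k)) = 1)"
      by blast
  qed
  moreover have "range f \<subseteq> X"
    using fX by blast
  ultimately show ?thesis
    unfolding distributionally_chaotic_def
    by (intro exI[of _ "range f"] conjI exI[of _ "(1/2) ^ m"]) auto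
qed

text \<open>Compared with the preceding criterion only a fixed lower bound \<delta> comes back. That
  is enough for (B), which concerns ratios: the denominators can be made small instead.\<close>

lemma distributionally_chaoticD:
  assumes "distributionally_chaotic X (frechet_dist X p) T"
  obtains u D m0 \<delta> where "u \<in> X" "u \<noteq> 0" "D \<subseteq> {1..}" "full_density (\<lambda>n. n \<in> D)"
    "\<And>k e. 1 \<le> k \<Longrightarrow> 0 < e \<Longrightarrow> \<exists>n0. \<forall>n\<in>D. n0 \<le> n \<longrightarrow> p k ((T ^^ n) u) < e"
    "0 < \<delta>" "1 \<le> m0" "\<And>m. m0 \<le> m \<Longrightarrow> full_density (\<lambda>n. \<delta> \<le> p m ((T ^^ n) u))"
proof -
  obtain \<Gamma> \<epsilon> where \<Gamma>: "\<Gamma> \<subseteq> X" "uncountable \<Gamma>" and \<epsilon>: "0 < \<epsilon>"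
    and pair: "\<forall>x\<in>\<Gamma>. \<forall>y\<in>\<Gamma>. x \<noteq> y \<longrightarrow>
      full_density (\<lambda>n. \<not> frechet_dist X p ((T ^^ n) x) ((T ^^ n) y) < \<epsilon>) \<and>
      (\<forall>\<tau>>0. full_density (\<lambda>n. frechet_dist X p ((T ^^ n) x) ((T ^^ n) y) < \<tau>))"
    using assms unfolding distributionally_chaotic_def limsup_card_eq_1_iff liminf_card_eq_0_iff
    by (elim exE conjE)
  have "\<not> (\<exists>x. \<Gamma> \<subseteq> {x})"
    using \<Gamma>(2) by (meson countable_empty countable_insert countable_subset)
  then obtain x y where xy: "x \<in> \<Gamma>" "y \<in> \<Gamma>" "x \<noteq> y"
    by blast
  then have X: "x \<in> X" "y \<in> X"
    using \<Gamma> by auto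
  define u where "u = x - y"
  have u: "u \<in> X" "u \<noteq> 0"
    using X xy by (auto simp: u_def)
  have d: "frechet_dist X p ((T ^^ n) x) ((T ^^ n) y) = frechet_dist X p ((T ^^ n) u) 0" for n
    using frechet_dist_translate[of "(T ^^ n) x" "(T ^^ n) y"] X
    by (simp add: u_def funpow_map_diff funpow_in)
  have far: "full_density (\<lambda>n. \<epsilon> \<le> frechet_dist X p ((T ^^ n) u) 0)"
    and near: "\<And>\<tau>. 0 < \<tau> \<Longrightarrow> full_density (\<lambda>n. frechet_dist X p ((T ^^ n) u) 0 < \<tau>)"
    using pair[rule_format, OF xy] by (simp_all add: d not_less)
  have small: "full_density (\<lambda>n. p (Suc j) ((T ^^ n) u) < 1 / real (Suc j))" for j
  proof (rule full_density_mono[OF near])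
    show "0 < (1/2) ^ Suc j * min 1 (1 / real (Suc j))"
      by simp
    fix n assume n: "frechet_dist X p ((T ^^ n) u) 0 < (1/2) ^ Suc j * min 1 (1 / real (Suc j))"
    have "(1/2) ^ Suc j * min 1 (p (Suc j) ((T ^^ n) u - 0)) \<le> frechet_dist X p ((T ^^ n) u) 0"
      by (rule frechet_dist_ge) (use u in auto)
    with n have "(1/2) ^ Suc j * min 1 (p (Suc j) ((T ^^ n) u)) < (1/2) ^ Suc j * min 1 (1 / real (Suc j))"
      by (simp only: diff_zero)
    then have "min 1 (p (Suc j) ((T ^^ n) u)) < min 1 (1 / real (Suc j))"
      by (rule mult_left_less_imp_less) simp
    then show "p (Suc j) ((T ^^ n) u) < 1 / real (Suc j)"
      by (auto simp: min_def split: if_splits)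
  qed
  \<comment> \<open>Tying the seminorm index and the tolerance to the same j makes one diagonal set
    serve all seminorms.\<close>
  obtain D where D: "D \<subseteq> {1..}" "full_density (\<lambda>n. n \<in> D)"
    "\<forall>j. \<exists>n0. \<forall>n\<in>D. n0 \<le> n \<longrightarrow> (\<exists>i\<ge>j. p (Suc i) ((T ^^ n) u) < 1 / real (Suc i))"
    by (rule full_density_diagonal[of "\<lambda>j n. p (Suc j) ((T ^^ n) u) < 1 / real (Suc j)", OF small]) blast
  have Dsmall: "\<exists>n0. \<forall>n\<in>D. n0 \<le> n \<longrightarrow> p k ((T ^^ n) u) < e" if k: "1 \<le> k" and e: "0 < e" for k e
  proof -
    obtain j0 where j0: "inverse (real (Suc j0)) < e"
      using reals_Archimedean[OF e] by blast
    obtain n0 where n0: "\<forall>n\<in>D. n0 \<le> n \<longrightarrow>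
        (\<exists>i\<ge>max j0 k. p (Suc i) ((T ^^ n) u) < 1 / real (Suc i))"
      using D(3) by blast
    have "p k ((T ^^ n) u) < e" if n: "n \<in> D" "n0 \<le> n" for n
    proof -
      obtain i where i: "max j0 k \<le> i" "p (Suc i) ((T ^^ n) u) < 1 / real (Suc i)"
        using n0 n by blast
      have "p k ((T ^^ n) u) \<le> p (Suc i) ((T ^^ n) u)"
        using k i(1) u by (intro seminorms_mono) auto
      moreover have "1 / real (Suc i) \<le> inverse (real (Suc j0))"
        using i(1) by (simp add: inverse_eq_divide frac_le)
      ultimately show ?thesis
        using i(2) j0 by linarith
    qed
    then show ?thesis by blast
  qed
  \<comment> \<open>Beyond \<open>p m0\<close>, the metric bound leaves less than \<epsilon> / 2, so
    \<open>p m0\<close> must supply the rest of a distance of at least \<epsilon>; monotonicity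
    covers larger m.\<close>
  obtain m0 where m0: "1 \<le> m0" "(1/2) ^ m0 < \<epsilon> / 2"
    using half_power_less[of "\<epsilon> / 2"] \<epsilon> by auto
  have "full_density (\<lambda>n. \<epsilon> / 2 \<le> p m ((T ^^ n) u))" if m: "m0 \<le> m" for m
  proof (rule full_density_mono[OF far])
    fix n assume n: "\<epsilon> \<le> frechet_dist X p ((T ^^ n) u) 0"
    have "frechet_dist X p ((T ^^ n) u) 0 \<le> p m0 ((T ^^ n) u - 0) + (1/2) ^ m0"
      by (rule frechet_dist_le) (use u m0 in auto)
    moreover have "p m0 ((T ^^ n) u) \<le> p m ((T ^^ n) u)"
      using m m0 u by (intro seminorms_mono) auto
    ultimately show "\<epsilon> / 2 \<le> p m ((T ^^ n) u)"
      using n m0(2) by simp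
  qed
  with \<epsilon> show ?thesis
    by (intro that[OF u D(1,2) Dsmall _ m0(1), of "\<epsilon> / 2"]) simp_all
qed

(* For a vector z with large orbit, T^n (v + (i/L) z) and T^n (v + (j/L) z) cannot both be small when
   i \<noteq> j.  Hence each time n is bad for at most one j \<le> L, and some j is bad for at most N/L times. *)
lemma perturb_to_large_orbit:
  assumes V: "subspace V" "V \<subseteq> X" and m: "1 \<le> m"
    and big: "\<And>k. 1 \<le> k \<Longrightarrow> \<exists>v\<in>V. \<exists>N\<ge>k. p (max m k) v \<noteq> 0 \<and>
      (1 - 1 / real k) * real N
        < real (card {n\<in>{1..N}. real k < p m ((T ^^ n) v) / p (max m k) v})"
    and v: "v \<in> V" and K: "1 \<le> K" and k0: "1 \<le> k0" and e: "0 < e"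
  obtains y N where "y \<in> V" "p k0 (y - v) < e" "K \<le> N"
    "(1 - 1 / real K) * real N < real (card {n\<in>{1..N}. real K < p m ((T ^^ n) y)})"
proof -
  \<comment> \<open>The tolerance 1 / K is split in two: 1 / L for the times at which the vector
    from (B) is not large, 1 / L for the bad times of the chosen multiple.\<close>
  define L where "L = 2 * K"
  define c where "c = e / 2"
  have c: "0 < c" "c < e"
    using e by (auto simp: c_def)
  have L: "1 \<le> L" "0 < real L"
    using K by (auto simp: L_def)
  obtain k1 :: nat where k1: "2 * real K * real L / c \<le> real k1"
    using real_arch_simple by blast
  \<comment> \<open>Three demands: k \<ge> k0 makes the perturbation small in \<open>p k0\<close>, k
    \<ge> L limits the exceptional times to N / L, and k \<ge> k1 makes the orbit of z, normalised
    to size c, exceed 2 K L at good times.\<close>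
  define k where "k = max (max k0 L) k1"
  have k: "1 \<le> k" "k0 \<le> k" "L \<le> k" "k1 \<le> k"
    using k0 by (auto simp: k_def)
  define q where "q = max m k"
  have q: "1 \<le> q" "k0 \<le> q" "k \<le> q"
    using k by (auto simp: q_def)
  obtain v' N where v': "v' \<in> V" "k \<le> N" "p q v' \<noteq> 0"
    "(1 - 1 / real k) * real N < real (card {n\<in>{1..N}. real k < p m ((T ^^ n) v') / p q v'})"
    using big[OF k(1)] by (auto simp: q_def)
  have vX: "v \<in> X" "v' \<in> X"
    using v v' V by auto
  note sm = seminorms[OF m] and sq = seminorms[OF q(1)] and sk0 = seminorms[OF k0]
  have pv': "0 < p q v'"
    using seminorm_nonneg[OF sq vX(2)] v'(3) by simp
  define z where "z = smul (of_real (c / p q v')) v'"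
  have z: "z \<in> V" "z \<in> X"
    using v' V vX by (auto simp: z_def intro: subspace_scale)
  have nz: "norm (of_real (c / p q v') :: 'k) = c / p q v'"
    using pv' c by (simp add: norm_of_real del: of_real_divide)
  have pz: "p q z = c"
    using pv' c by (simp add: z_def seminorm_scale[OF sq vX(2)] nz del: of_real_divide)
  define Good where "Good = (\<lambda>n. real k < p m ((T ^^ n) v') / p q v')"
  have good: "2 * real K < p m ((T ^^ n) z) / real L" if "Good n" for n
  proof -
    have "p m ((T ^^ n) z) = c * (p m ((T ^^ n) v') / p q v')"
      unfolding z_def funpow_map_scale[OF vX(2)] seminorm_scale[OF sm funpow_in[OF vX(2)]] nz
      by simp
    moreover have "2 * real K * real L \<le> c * real k"
    proof -
      have "2 * real K * real L \<le> c * real k1"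
        using k1 c(1) by (simp only: pos_divide_le_eq mult.commute)
      also have "\<dots> \<le> c * real k"
        using c(1) k(4) by (intro mult_left_mono) auto
      finally show ?thesis .
    qed
    moreover have "c * real k < c * (p m ((T ^^ n) v') / p q v')"
      using mult_strict_left_mono[OF _ c(1)] that unfolding Good_def by blast
    ultimately have "2 * real K * real L < p m ((T ^^ n) z)"
      by linarith
    then show ?thesis
      by (simp only: pos_less_divide_eq[OF L(2)])
  qed
  define y where "y = (\<lambda>j::nat. v + smul (of_real (real j / real L)) z)"
  have yV: "y j \<in> V" for j
    unfolding y_def by (intro subspace_add[OF V(1)] subspace_scale[OF V(1)] v z)
  then have yX: "y j \<in> X" for j
    using V(2) by blast
  have Ty: "(T ^^ n) (y j) = (T ^^ n) v + smul (of_real (real j / real L)) ((T ^^ n) z)" for n j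
    unfolding y_def funpow_map_add[OF vX(1) scale_in[OF z(2)]] funpow_map_scale[OF z(2)] ..
  \<comment> \<open>Distinct integers differ by at least 1, so two of the perturbed orbits are at
    least (1/L) T^n z apart in \<open>p m\<close>; at good times this exceeds 2 K.\<close>
  have gap: "p m ((T ^^ n) z) / real L \<le> p m ((T ^^ n) (y i)) + p m ((T ^^ n) (y j))"
    if "i \<noteq> j" for i j n
  proof -
    have "(T ^^ n) (y i) - (T ^^ n) (y j) = smul (of_real ((real i - real j) / real L)) ((T ^^ n) z)"
      by (simp only: Ty diff_divide_distrib of_real_diff scale_left_diff_distrib add_diff_cancel_left)
    then have "p m ((T ^^ n) (y i) - (T ^^ n) (y j)) = \<bar>real i - real j\<bar> / real L * p m ((T ^^ n) z)"
      by (simp only: seminorm_scale[OF sm funpow_in[OF z(2)]] norm_of_real abs_divide abs_of_nat)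
    moreover have "1 / real L * p m ((T ^^ n) z) \<le> \<bar>real i - real j\<bar> / real L * p m ((T ^^ n) z)"
    proof (intro mult_right_mono divide_right_mono)
      show "1 \<le> \<bar>real i - real j\<bar>"
        using that by linarith
    qed (use seminorm_nonneg[OF sm funpow_in[OF z(2)]] in auto)
    moreover have "p m ((T ^^ n) (y i) - (T ^^ n) (y j)) \<le> p m ((T ^^ n) (y i)) + p m ((T ^^ n) (y j))"
      by (intro seminorm_diff_triangle[OF sm] funpow_in yX)
    moreover have "p m ((T ^^ n) z) / real L = 1 / real L * p m ((T ^^ n) z)"
      by simp
    ultimately show ?thesis
      by linarith
  qed
  \<comment> \<open>Only good times are charged to j; the others are already accounted for in the
    estimate for v'.\<close>
  define Bad where "Bad = (\<lambda>j n. Good n \<and> p m ((T ^^ n) (y j)) \<le> real K)"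
  have bad: "i = j" if "Bad i n" "Bad j n" for i j n
  proof (rule ccontr)
    assume "i \<noteq> j"
    from gap[OF this, of n] good[of n] that show False
      by (simp add: Bad_def)
  qed
  have "\<exists>j\<in>{1..L}. L * card {n\<in>{1..N}. Bad j n} \<le> N"
    by (rule sparse_index[OF L(1) bad])
  then obtain j where j: "j \<in> {1..L}" "L * card {n\<in>{1..N}. Bad j n} \<le> N"
    by blast
  have "{n\<in>{1..N}. Good n} \<subseteq> {n\<in>{1..N}. real K < p m ((T ^^ n) (y j))} \<union> {n\<in>{1..N}. Bad j n}"
    by (auto simp: Bad_def)
  then have "card {n\<in>{1..N}. Good n}
      \<le> card ({n\<in>{1..N}. real K < p m ((T ^^ n) (y j))} \<union> {n\<in>{1..N}. Bad j n})"
    by (intro card_mono) auto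
  also have "\<dots> \<le> card {n\<in>{1..N}. real K < p m ((T ^^ n) (y j))} + card {n\<in>{1..N}. Bad j n}"
    by (rule card_Un_le)
  finally have "real (card {n\<in>{1..N}. Good n})
      \<le> real (card {n\<in>{1..N}. real K < p m ((T ^^ n) (y j))}) + real (card {n\<in>{1..N}. Bad j n})"
    by linarith
  moreover have "real (card {n\<in>{1..N}. Bad j n}) \<le> 1 / real L * real N"
  proof -
    have "real L * real (card {n\<in>{1..N}. Bad j n}) \<le> real N"
      using j(2) by (simp only: of_nat_mult[symmetric] of_nat_le_iff)
    then show ?thesis
      using L by (simp add: field_simps)
  qed
  moreover have "(1 - 1 / real L) * real N \<le> (1 - 1 / real k) * real N"
    using L k by (intro mult_right_mono diff_left_mono frac_le) auto
  moreover have "(1 - 1 / real L) * real N - 1 / real L * real N = (1 - 1 / real K) * real N"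
    using K by (simp add: L_def field_simps)
  ultimately have "(1 - 1 / real K) * real N < real (card {n\<in>{1..N}. real K < p m ((T ^^ n) (y j))})"
    using v'(4) by (simp add: Good_def)
  moreover have "p k0 (y j - v) < e"
  proof -
    have "p k0 (y j - v) = real j / real L * p k0 z"
      using z by (simp add: y_def seminorm_scale[OF sk0] norm_of_real del: of_real_divide)
    also have "\<dots> \<le> 1 * p k0 z"
      using j(1) L seminorm_nonneg[OF sk0 z(2)] by (intro mult_right_mono) auto
    also have "p k0 z \<le> p q z"
      by (rule seminorms_mono[OF k0 q(2) z(2)])
    finally show ?thesis
      using pz c by simp
  qed
  moreover have "K \<le> N"
    using k v'(2) by (auto simp: L_def)
  ultimately show ?thesis
    by (intro that[of "y j" N] yV)
qed

text \<open>Working in the closure of V rather than in X makes V dense in a complete space, so the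
  two properties need to be approximated only near vectors of V.\<close>

lemma distributional_chaos_criterion:
  assumes V: "subspace V" "V \<subseteq> X" and D: "full_density (\<lambda>n. n \<in> D)"
    and small: "\<And>v k e. v \<in> V \<Longrightarrow> 1 \<le> k \<Longrightarrow> 0 < e \<Longrightarrow>
      \<exists>n0. \<forall>n\<in>D. n0 \<le> n \<longrightarrow> p k ((T ^^ n) v) < e"
    and m: "1 \<le> m"
    and big: "\<And>k. 1 \<le> k \<Longrightarrow> \<exists>v\<in>V. \<exists>N\<ge>k. p (max m k) v \<noteq> 0 \<and>
      (1 - 1 / real k) * real N
        < real (card {n\<in>{1..N}. real k < p m ((T ^^ n) v) / p (max m k) v})"
  shows "distributionally_chaotic X (frechet_dist X p) T"
proof -
  define Y where "Y = mtopology closure_of V"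
  define Z where "Z = subtopology mtopology Y"
  have VY: "V \<subseteq> Y"
    unfolding Y_def by (rule closure_of_subset) (use V in simp)
  have YX: "Y \<subseteq> X"
    unfolding Y_def using closure_of_subset_topspace by fastforce
  have topZ: "topspace Z = Y"
    using YX by (auto simp: Z_def)
  have Zc: "completely_metrizable_space Z"
    unfolding Z_def Y_def
    by (intro completely_metrizable_space_closedin closedin_closure_of
        completely_metrizable_space_mtopology complete)
  \<comment> \<open>The parameter K is at once seminorm index, tolerance and lower bound for N, so
    countably many open sets suffice.\<close>
  define G where "G = (\<lambda>K. {x\<in>X. \<exists>N\<ge>K. (1 - 1 / real K) * real N
    < real (card {n\<in>{1..N}. p K ((T ^^ n) x) < 1 / real K})})"
  define H where "H = (\<lambda>K. {x\<in>X. \<exists>N\<ge>K. (1 - 1 / real K) * real N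
    < real (card {n\<in>{1..N}. real K < p m ((T ^^ n) x)})})"
  have Gopen: "openin mtopology (G K)" if "1 \<le> K" for K
    using openin_card_greater[of mtopology "\<lambda>x n. p K ((T ^^ n) x) < 1 / real K"]
      openin_seminorm_less[OF continuous_seminorm_funpow[OF continuous_seminorm_p[OF that]]]
    by (simp add: G_def)
  have Hopen: "openin mtopology (H K)" for K
    using openin_card_greater[of mtopology "\<lambda>x n. real K < p m ((T ^^ n) x)"]
      openin_seminorm_greater[OF continuous_seminorm_funpow[OF continuous_seminorm_p[OF m]]]
    by (simp add: H_def)
  have VG: "V \<subseteq> G K" if K: "1 \<le> K" for K
  proof
    fix v assume v: "v \<in> V"
    obtain n0 where n0: "\<forall>n\<in>D. n0 \<le> n \<longrightarrow> p K ((T ^^ n) v) < 1 / real K"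
      using small[OF v K, of "1 / real K"] K by auto
    have "full_density (\<lambda>n. p K ((T ^^ n) v) < 1 / real K)"
      by (rule full_density_mono[OF full_density_tail[OF D, of n0]]) (use n0 in auto)
    then obtain N where "K \<le> N"
      "(1 - 1 / real K) * real N < real (card {n\<in>{1..N}. p K ((T ^^ n) v) < 1 / real K})"
      using full_densityD[of _ "1 / real K" K] K by auto
    with v V show "v \<in> G K"
      by (auto simp: G_def)
  qed
  have VH: "\<exists>y\<in>H K \<inter> V. y \<in> W" if v: "v \<in> V" and K: "1 \<le> K" and W: "openin mtopology W" "v \<in> W" for v K W
  proof -
    obtain k0 e where ke: "1 \<le> k0" "0 < e" "\<forall>y\<in>X. p k0 (y - v) < e \<longrightarrow> y \<in> W"
      using W unfolding frechet_open_iff by blast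
    obtain y N where y: "y \<in> V" "p k0 (y - v) < e" "K \<le> N"
      "(1 - 1 / real K) * real N < real (card {n\<in>{1..N}. real K < p m ((T ^^ n) y)})"
      by (rule perturb_to_large_orbit[OF V m big v K ke(1,2)]) blast
    have "y \<in> X"
      using y(1) V by blast
    moreover from this y(3,4) have "y \<in> H K"
      unfolding H_def by blast
    ultimately show ?thesis
      using y(1,2) ke(3) by blast
  qed
  \<comment> \<open>Approximation near points of V is enough, because a closed set containing V
    contains its closure Y.\<close>
  have dense: "Z closure_of (U \<inter> Y) = topspace Z"
    if U: "\<And>v W. v \<in> V \<Longrightarrow> openin mtopology W \<Longrightarrow> v \<in> W \<Longrightarrow> \<exists>y\<in>U \<inter> V. y \<in> W" for U
  proof -
    have "V \<subseteq> mtopology closure_of (U \<inter> Y)"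
    proof
      fix v assume v: "v \<in> V"
      have "\<exists>y. y \<in> U \<inter> Y \<and> y \<in> W" if "v \<in> W \<and> openin mtopology W" for W
        using U[OF v, of W] that VY by blast
      with v V show "v \<in> mtopology closure_of (U \<inter> Y)"
        unfolding in_closure_of by auto
    qed
    then have "Y \<subseteq> mtopology closure_of (U \<inter> Y)"
      unfolding Y_def by (rule closure_of_minimal) simp
    then show ?thesis
      unfolding topZ by (auto simp: Z_def closure_of_subtopology Int_absorb1)
  qed
  \<comment> \<open>\<open>Suc K\<close> skips the index 0, at which \<open>p\<close> is
    unconstrained.\<close>
  define U where "U = (\<lambda>K. G (Suc K) \<inter> H (Suc K) \<inter> Y)"
  obtain u where u: "u \<in> Y" "\<And>K. u \<in> U K"
  proof (rule Baire_sequence[of Z U, OF Zc])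
    show "topspace Z \<noteq> {}"
      using topZ VY subspace_0[OF V(1)] by blast
    fix K
    show "openin Z (U K)"
      unfolding Z_def U_def openin_subtopology using Gopen[of "Suc K"] Hopen[of "Suc K"] by auto
    show "Z closure_of U K = topspace Z"
      unfolding U_def
    proof (rule dense)
      fix v W assume "v \<in> V" "openin mtopology W" "v \<in> W"
      then obtain y where "y \<in> H (Suc K) \<inter> V" "y \<in> W"
        using VH[of v "Suc K" W] by auto
      \<comment> \<open>The perturbed vector stays in V and hence in \<open>G (Suc K)\<close>, so
        one point meets both conditions.\<close>
      with VG[of "Suc K"] show "\<exists>y\<in>G (Suc K) \<inter> H (Suc K) \<inter> V. y \<in> W"
        by auto
    qed
  next
    fix x assume "x \<in> topspace Z" "\<And>K. x \<in> U K"
    then show thesis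
      by (intro that) (simp_all add: topZ)
  qed
  have uX: "u \<in> X"
    using u YX by blast
  have u': "u \<in> G K" "u \<in> H K" if "1 \<le> K" for K
    using u(2)[of "K - 1"] that by (auto simp: U_def)
  show ?thesis
  proof (rule distributionally_chaoticI[OF uX m])
    fix k :: nat and e :: real
    assume k: "1 \<le> k" and e: "0 < e"
    obtain j where j: "inverse (real (Suc j)) < e"
      using reals_Archimedean[OF e] by blast
    show "full_density (\<lambda>n. p k ((T ^^ n) u) < e)"
    proof (rule full_densityI_nested)
      show "\<exists>N\<ge>K. (1 - 1 / real K) * real N
          < real (card {n\<in>{1..N}. p K ((T ^^ n) u) < 1 / real K})" if "1 \<le> K" for K
        using u'(1)[OF that] by (simp add: G_def)
      fix K n assume K: "max k (Suc j) \<le> K" "p K ((T ^^ n) u) < 1 / real K"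
      have "p k ((T ^^ n) u) \<le> p K ((T ^^ n) u)"
        using k K(1) uX by (intro seminorms_mono) auto
      moreover have "1 / real K \<le> inverse (real (Suc j))"
        using K(1) by (simp add: inverse_eq_divide frac_le)
      ultimately show "p k ((T ^^ n) u) < e"
        using K(2) j by linarith
    qed
  next
    fix R :: real
    obtain j :: nat where j: "R \<le> real j"
      using real_arch_simple by blast
    show "full_density (\<lambda>n. R < p m ((T ^^ n) u))"
    proof (rule full_densityI_nested)
      show "\<exists>N\<ge>K. (1 - 1 / real K) * real N
          < real (card {n\<in>{1..N}. real K < p m ((T ^^ n) u)})" if "1 \<le> K" for K
        using u'(2)[OF that] by (simp add: H_def)
      fix K n assume "j \<le> K" "real K < p m ((T ^^ n) u)"
      with j show "R < p m ((T ^^ n) u)"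
        by linarith
    qed
  qed
qed

end

section \<open>Weighted shifts\<close>

lemma sum_fun_apply: "(\<Sum>i\<in>A. f i) x = (\<Sum>i\<in>A. f i x)"
  by (induction A rule: infinite_finite_induct) auto

text \<open>Read at i - n, the coordinate has collected exactly the weights from i - 1 down to i -
  n, so each further power contributes one new factor.\<close>

lemma backward_shift_funpow_nth:
  "(backward_shift w ^^ n) x (i - int n) = weight_prod w i n * x i"
proof (induction n)
  case (Suc n)
  have "i - int (Suc n) + 1 = i - int n"
    by simp
  then have "(backward_shift w ^^ Suc n) x (i - int (Suc n))
      = w (i - int (Suc n)) * (backward_shift w ^^ n) x (i - int n)"
    by (simp only: funpow.simps o_apply backward_shift_def)
  also have "\<dots> = weight_prod w i (Suc n) * x i"
    unfolding Suc.IH by (simp add: weight_prod_def)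
  finally show ?case .
qed (simp add: weight_prod_def)

lemma backward_shift_funpow_canonical_vec:
  "(backward_shift w ^^ n) (canonical_vec i)
     = seq_scale (weight_prod w i n) (canonical_vec (i - int n))"
proof
  fix j
  have "(backward_shift w ^^ n) (canonical_vec i) ((j + int n) - int n)
      = weight_prod w (j + int n) n * canonical_vec i (j + int n)"
    by (rule backward_shift_funpow_nth)
  then show "(backward_shift w ^^ n) (canonical_vec i) j
      = seq_scale (weight_prod w i n) (canonical_vec (i - int n)) j"
    by (auto simp: seq_scale_def canonical_vec_def)
qed

lemma sum_canonical_vec:
  assumes "finite F"
  shows "(\<Sum>i\<in>F. seq_scale (x i) (canonical_vec i)) = (\<lambda>i. if i \<in> F then x i else 0)"
proof
  fix j
  have "(\<Sum>i\<in>F. seq_scale (x i) (canonical_vec i)) j = (\<Sum>i\<in>F. if i = j then x i else 0)"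
    unfolding sum_fun_apply by (intro sum.cong) (auto simp: seq_scale_def canonical_vec_def)
  with assms show "(\<Sum>i\<in>F. seq_scale (x i) (canonical_vec i)) j = (if j \<in> F then x j else 0)"
    by simp
qed

lemma strictly_increasing_choice:
  fixes Q :: "nat \<Rightarrow> nat \<Rightarrow> bool"
  assumes "\<And>k K. 1 \<le> k \<Longrightarrow> \<exists>N\<ge>K. Q k N"
  shows "\<exists>N. (\<forall>k\<ge>1. Q k (N k) \<and> 1 \<le> N k) \<and> strict_mono N"
proof -
  obtain g where g: "\<And>k K. 1 \<le> k \<Longrightarrow> K \<le> g k K" "\<And>k K. 1 \<le> k \<Longrightarrow> Q k (g k K)"
    using assms by metis
  \<comment> \<open>The value at 0 is only a seed; requesting at least \<open>Suc (N k)\<close> in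
    the next choice yields both strict growth and positivity from index 1 on.\<close>
  define N where "N = rec_nat 0 (\<lambda>k M. g (Suc k) (Suc M))"
  have N: "N (Suc k) = g (Suc k) (Suc (N k))" for k
    by (simp add: N_def)
  have "N k < N (Suc k)" for k
    unfolding N using g(1)[of "Suc k" "Suc (N k)"] by simp
  then have mono: "strict_mono N"
    by (simp add: strict_mono_Suc_iff)
  have "Q k (N k) \<and> 1 \<le> N k" if "1 \<le> k" for k
  proof (cases k)
    case (Suc k')
    then show ?thesis
      using g(1)[of "Suc k'" "Suc (N k')"] g(2)[of "Suc k'"] by (simp add: N)
  qed (use that in simp)
  with mono show ?thesis by blast
qed

section \<open>Coordinates and basis expansions\<close>

context frechet_sequence_space
begin

lemma continuous_seminorm_coordinate: "continuous_seminorm (\<lambda>x. norm (x n))"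
proof -
  have "continuous_map mtopology euclidean (\<lambda>x. x n)"
    using continuous_inclusion unfolding continuous_map_componentwise_UNIV by simp
  then have "openin mtopology {x \<in> topspace mtopology. x n \<in> ball 0 1}"
    by (rule openin_continuous_map_preimage) simp
  moreover have "0 \<in> {x \<in> topspace mtopology. x n \<in> ball 0 1}"
    by simp
  ultimately obtain k e where ke: "1 \<le> k" "0 < e"
    "\<forall>y\<in>X. p k (y - 0) < e \<longrightarrow> y \<in> {x \<in> topspace mtopology. x n \<in> ball 0 1}"
    unfolding frechet_open_iff by blast
  have "seminorm_on seq_scale X (\<lambda>x. norm (x n))"
    by (auto simp: seminorm_on_def seq_scale_def norm_mult norm_triangle_ineq)
  from continuous_seminormI[OF this ke(1,2), of 1] ke(3) show ?thesis
    by (auto simp: less_imp_le)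
qed

text \<open>Increments of a convergent sequence are eventually at most 2 in the seminorm, and the
  finitely many earlier ones are bounded by their sum. Applied to partial sums, this bounds the
  terms of the basis expansion.\<close>

lemma bounded_increments:
  assumes S: "limitin mtopology S u sequentially" and k: "1 \<le> k" and SX: "\<And>N. S N \<in> X"
  shows "\<exists>R. \<forall>N. p k (S (Suc N) - S N) \<le> R"
proof -
  note sk = seminorms[OF k]
  have u: "u \<in> X"
    using S by (simp add: frechet_limitin_iff)
  have "\<forall>\<^sub>F N in sequentially. S N \<in> X \<and> p k (S N - u) < 1"
    using S k by (simp add: frechet_limitin_iff)
  then obtain N0 where N0: "\<And>N. N0 \<le> N \<Longrightarrow> p k (S N - u) < 1"
    by (auto simp: eventually_sequentially)
  have tail: "p k (S (Suc N) - S N) \<le> 2" if "N0 \<le> N" for N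
  proof -
    have "p k ((S (Suc N) - u) - (S N - u)) \<le> p k (S (Suc N) - u) + p k (S N - u)"
      by (intro seminorm_diff_triangle[OF sk] diff_in SX u)
    with N0[of N] N0[of "Suc N"] that show ?thesis
      by simp
  qed
  have nn: "0 \<le> p k (S (Suc N) - S N)" for N
    by (intro seminorm_nonneg[OF sk] diff_in SX)
  show ?thesis
  proof (intro exI allI)
    fix N
    show "p k (S (Suc N) - S N) \<le> 2 + (\<Sum>N<N0. p k (S (Suc N) - S N))"
    proof (cases "N0 \<le> N")
      case True
      with tail[OF True] show ?thesis
        using sum_nonneg[of "{..<N0}" "\<lambda>N. p k (S (Suc N) - S N)"] nn by fastforce
    next
      case False
      then have "p k (S (Suc N) - S N) \<le> (\<Sum>N<N0. p k (S (Suc N) - S N))"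
        by (intro member_le_sum) (use nn in auto)
      then show ?thesis
        by simp
    qed
  qed
qed

context
  assumes basis: "canonical_basis X p"
begin

lemma canonical_vec_in: "canonical_vec i \<in> X"
  using basis by (auto simp: canonical_basis_def)

lemma bounded_basis_terms:
  assumes x: "x \<in> X" and k: "1 \<le> k"
  shows "\<exists>R. \<forall>n. p k (seq_scale (x n) (canonical_vec n)) \<le> R"
proof -
  define f where "f = (\<lambda>n. seq_scale (x n) (canonical_vec n))"
  have f: "f n \<in> X" for n
    by (auto simp: f_def canonical_vec_in)
  obtain u v where u: "limitin mtopology (\<lambda>N. \<Sum>n\<le>N. f (int n)) u sequentially"
    and v: "limitin mtopology (\<lambda>N. \<Sum>n=1..N. f (- int n)) v sequentially"
    using basis x unfolding canonical_basis_def f_def by blast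
  obtain R1 where R1: "\<forall>N. p k ((\<Sum>n\<le>Suc N. f (int n)) - (\<Sum>n\<le>N. f (int n))) \<le> R1"
    using bounded_increments[OF u k subspace_sum[OF subspace_carrier f]] by blast
  obtain R2 where R2: "\<forall>N. p k ((\<Sum>n=1..Suc N. f (- int n)) - (\<Sum>n=1..N. f (- int n))) \<le> R2"
    using bounded_increments[OF v k subspace_sum[OF subspace_carrier f]] by blast
  \<comment> \<open>Every f n with n \<noteq> 0 is an increment of one of the two partial sums; f 0
    is the initial partial sum of the first series and is bounded separately.\<close>
  have "p k (f n) \<le> max (p k (f 0)) (max R1 R2)" for n
  proof (cases n "0 :: int" rule: linorder_cases)
    case less
    then have n: "n = - int (Suc (nat (- n) - 1))"
      by simp
    show ?thesis
      using R2[rule_format, of "nat (- n) - 1"] by (subst n) (simp del: of_nat_Suc)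
  next
    case greater
    then have n: "n = int (Suc (nat n - 1))"
      by simp
    show ?thesis
      using R1[rule_format, of "nat n - 1"] by (subst n) (simp del: of_nat_Suc)
  qed simp
  then show ?thesis
    unfolding f_def by blast
qed

text \<open>The point is that k' and C do not depend on n: in (A) the coordinate i - n moves with
  the time n.\<close>

lemma basis_terms_equicontinuous:
  assumes k: "1 \<le> k"
  obtains k' C where "1 \<le> k'"
    "\<And>n x. x \<in> X \<Longrightarrow> p k (seq_scale (x n) (canonical_vec n)) \<le> C * p k' x"
proof (rule uniform_boundedness[of "\<lambda>n x. p k (seq_scale (x n) (canonical_vec n))"])
  note sk = seminorms[OF k]
  fix n
  have eq: "p k (seq_scale (x n) (canonical_vec n)) = norm (x n) * p k (canonical_vec n)" for x :: "int \<Rightarrow> 'k"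
    by (rule seminorm_scale[OF sk canonical_vec_in])
  have nn: "0 \<le> p k (canonical_vec n)"
    by (rule seminorm_nonneg[OF sk canonical_vec_in])
  obtain k' C where kC: "1 \<le> k'" "0 < C" "\<And>x. x \<in> X \<Longrightarrow> norm (x n) \<le> C * p k' x"
    using continuous_seminorm_coordinate[of n] unfolding continuous_seminorm_def by blast
  show "continuous_seminorm (\<lambda>x. p k (seq_scale (x n) (canonical_vec n)))"
    unfolding eq continuous_seminorm_def
  \<comment> \<open>Adding 1 keeps the constant positive even if \<open>p k\<close> vanishes on the
    canonical vector.\<close>
  proof (intro conjI exI[of _ k'] exI[of _ "C * (p k (canonical_vec n) + 1)"] ballI)
    show "seminorm_on seq_scale X (\<lambda>x. norm (x n) * p k (canonical_vec n))"
      unfolding seminorm_on_def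
      using nn by (auto simp: seq_scale_def norm_mult distrib_right[symmetric]
          intro!: mult_right_mono norm_triangle_ineq)
    fix x assume x: "x \<in> X"
    have "norm (x n) * p k (canonical_vec n) \<le> norm (x n) * (p k (canonical_vec n) + 1)"
      by (intro mult_left_mono) auto
    also have "\<dots> \<le> (C * p k' x) * (p k (canonical_vec n) + 1)"
      using kC(3)[OF x] nn by (intro mult_right_mono) auto
    finally show "norm (x n) * p k (canonical_vec n) \<le> C * (p k (canonical_vec n) + 1) * p k' x"
      by (simp add: ac_simps)
  qed (use kC nn in auto)
qed (use bounded_basis_terms k that in auto)

lemma finite_truncation:
  assumes x: "x \<in> X" and k: "1 \<le> k" and e: "0 < e"
  obtains F where "finite F" "p k ((\<lambda>i. if i \<in> F then x i else 0) - x) < e"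
proof -
  note sk = seminorms[OF k]
  define f where "f = (\<lambda>n. seq_scale (x n) (canonical_vec n))"
  have f: "f n \<in> X" for n
    by (auto simp: f_def canonical_vec_in)
  have sumX: "(\<Sum>i\<in>A. f (g i)) \<in> X" for A and g :: "nat \<Rightarrow> int"
    by (intro subspace_sum[OF subspace_carrier] f)
  obtain u v where u: "limitin mtopology (\<lambda>N. \<Sum>n\<le>N. f (int n)) u sequentially"
    and v: "limitin mtopology (\<lambda>N. \<Sum>n=1..N. f (- int n)) v sequentially" and xuv: "x = u + v"
    using basis x unfolding canonical_basis_def f_def by blast
  have uv: "u \<in> X" "v \<in> X"
    using u v by (auto simp: frechet_limitin_iff)
  have "\<forall>\<^sub>F N in sequentially. p k ((\<Sum>n\<le>N. f (int n)) - u) < e / 2"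
    "\<forall>\<^sub>F N in sequentially. p k ((\<Sum>n=1..N. f (- int n)) - v) < e / 2"
    using u v k half_gt_zero[OF e] unfolding frechet_limitin_iff eventually_conj_iff by blast+
  then have "\<forall>\<^sub>F N in sequentially. p k ((\<Sum>n\<le>N. f (int n)) - u) < e / 2
      \<and> p k ((\<Sum>n=1..N. f (- int n)) - v) < e / 2"
    by (rule eventually_conj)
  then obtain N where N: "p k ((\<Sum>n\<le>N. f (int n)) - u) < e / 2"
    "p k ((\<Sum>n=1..N. f (- int n)) - v) < e / 2"
    by (auto simp: eventually_sequentially)
  define F1 where "F1 = int ` {..N}"
  define F2 where "F2 = (\<lambda>n. - int n) ` {1..N}"
  have F: "finite F1" "finite F2" "F1 \<inter> F2 = {}"
    by (auto simp: F1_def F2_def)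
  have "(\<Sum>n\<le>N. f (int n)) = sum f F1"
    unfolding F1_def by (subst sum.reindex) auto
  moreover have "(\<Sum>n=1..N. f (- int n)) = sum f F2"
    unfolding F2_def by (subst sum.reindex) (auto simp: inj_on_def)
  ultimately have "((\<Sum>n\<le>N. f (int n)) - u) + ((\<Sum>n=1..N. f (- int n)) - v) = sum f (F1 \<union> F2) - x"
    by (simp add: sum.union_disjoint F xuv)
  moreover have "sum f (F1 \<union> F2) = (\<lambda>i. if i \<in> F1 \<union> F2 then x i else 0)"
    unfolding f_def by (rule sum_canonical_vec) (use F in simp)
  moreover have "p k (((\<Sum>n\<le>N. f (int n)) - u) + ((\<Sum>n=1..N. f (- int n)) - v))
      \<le> p k ((\<Sum>n\<le>N. f (int n)) - u) + p k ((\<Sum>n=1..N. f (- int n)) - v)"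
    by (intro seminorm_triangle[OF sk] diff_in sumX uv)
  ultimately show ?thesis
    using N F by (intro that[of "F1 \<union> F2"]) simp_all
qed

end

end

section \<open>The weighted shift and condition (B)\<close>

locale weighted_shift = frechet_sequence_space X p
  for X :: "(int \<Rightarrow> 'k::{real_normed_field,banach}) set" and p :: "nat \<Rightarrow> (int \<Rightarrow> 'k) \<Rightarrow> real" +
  fixes w :: "int \<Rightarrow> 'k"
  assumes basis: "canonical_basis X p"
    and shift_in: "backward_shift w ` X \<subseteq> X"
    and shift_continuous:
      "continuous_map (frechet_topology X p) (frechet_topology X p) (backward_shift w)"
begin

sublocale frechet_operator seq_scale X p "backward_shift w"
proof
  show "backward_shift w x \<in> X" if "x \<in> X" for x
    using shift_in that by blast
qed (auto simp: backward_shift_def seq_scale_def algebra_simps shift_continuous)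

text \<open>Spelled exactly as the inner condition of (B), so that the statement of the theorem can
  be folded to it.\<close>

definition large_orbit :: "int set \<Rightarrow> nat \<Rightarrow> nat \<Rightarrow> nat \<Rightarrow> bool" where
  "large_orbit I m k N \<longleftrightarrow> (\<exists>(r :: nat) (i :: nat \<Rightarrow> int) (b :: nat \<Rightarrow> 'k).
     let q = (if k \<le> m then m else k);
         v = (\<Sum>j=1..r. seq_scale (b j) (canonical_vec (i j)))
     in 1 \<le> r \<and> (\<forall>j\<in>{1..r}. i j \<in> I \<and> b j \<noteq> 0) \<and>
        p q v \<noteq> 0 \<and>
        real (card {n\<in>{1..N}.
          p m (\<Sum>j=1..r. seq_scale (b j * weight_prod w (i j) n) (canonical_vec (i j - int n)))
            / p q v > real k})
          > (1 - 1 / real k) * real N)"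

lemma funpow_finite_sum:
  fixes r :: nat
  shows "(backward_shift w ^^ n) (\<Sum>j=1..r. seq_scale (b j) (canonical_vec (i j)))
     = (\<Sum>j=1..r. seq_scale (b j * weight_prod w (i j) n) (canonical_vec (i j - int n)))"
proof -
  have "(backward_shift w ^^ n) (\<Sum>j=1..r. seq_scale (b j) (canonical_vec (i j)))
      = (\<Sum>j=1..r. (backward_shift w ^^ n) (seq_scale (b j) (canonical_vec (i j))))"
    by (rule funpow_map_sum) (simp_all add: scale_in canonical_vec_in[OF basis])
  also have "\<dots> = (\<Sum>j=1..r. seq_scale (b j * weight_prod w (i j) n) (canonical_vec (i j - int n)))"
    by (intro sum.cong refl) (simp add: funpow_map_scale canonical_vec_in[OF basis]
        backward_shift_funpow_canonical_vec)
  finally show ?thesis .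
qed

lemma span_canonical_vec_finite_support:
  assumes "v \<in> span (canonical_vec ` I)"
  shows "finite {i. v i \<noteq> 0}" "{i. v i \<noteq> 0} \<subseteq> I"
proof -
  let ?S = "{v :: int \<Rightarrow> 'k. finite {i. v i \<noteq> 0} \<and> {i. v i \<noteq> 0} \<subseteq> I}"
  have "subspace ?S"
    unfolding subspace_def
  proof (intro conjI ballI allI)
    fix x y assume xy: "x \<in> ?S" "y \<in> ?S"
    have "{i. (x + y) i \<noteq> 0} \<subseteq> {i. x i \<noteq> 0} \<union> {i. y i \<noteq> 0}"
      by auto
    with xy show "x + y \<in> ?S"
      using finite_subset by blast
  next
    fix c x assume x: "x \<in> ?S"
    have "{i. seq_scale c x i \<noteq> 0} \<subseteq> {i. x i \<noteq> 0}"
      by (auto simp: seq_scale_def)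
    with x show "seq_scale c x \<in> ?S"
      using finite_subset by blast
  qed simp
  moreover have "canonical_vec ` I \<subseteq> ?S"
  proof
    fix x :: "int \<Rightarrow> 'k" assume "x \<in> canonical_vec ` I"
    then obtain i where "i \<in> I" "{j. x j \<noteq> 0} = {i}"
      by (auto simp: canonical_vec_def)
    then show "x \<in> ?S"
      by simp
  qed
  ultimately have "v \<in> ?S"
    using assms span_minimal by blast
  then show "finite {i. v i \<noteq> 0}" "{i. v i \<noteq> 0} \<subseteq> I"
    by auto
qed

text \<open>Conversely to summing up, a vector of the span is expanded over its support, which has
  only nonzero coefficients and indices in I; the support is nonempty because the denominator is
  nonzero.\<close>

lemma large_orbit_iff:
  assumes k: "1 \<le> k"
  shows "large_orbit I m k N \<longleftrightarrow> (\<exists>v\<in>span (canonical_vec ` I). p (max m k) v \<noteq> 0 \<and>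
     (1 - 1 / real k) * real N
       < real (card {n\<in>{1..N}. real k < p m ((backward_shift w ^^ n) v) / p (max m k) v}))"
  (is "_ \<longleftrightarrow> ?R")
proof -
  have q: "(if k \<le> m then m else k) = max m k"
    by simp
  show ?thesis
  proof
    assume "large_orbit I m k N"
    then obtain r :: nat and i b where rib: "\<forall>j\<in>{1..r}. i j \<in> I \<and> b j \<noteq> (0::'k)"
      "p (max m k) (\<Sum>j=1..r. seq_scale (b j) (canonical_vec (i j))) \<noteq> 0"
      "(1 - 1 / real k) * real N < real (card {n\<in>{1..N}. real k <
         p m ((backward_shift w ^^ n) (\<Sum>j=1..r. seq_scale (b j) (canonical_vec (i j))))
           / p (max m k) (\<Sum>j=1..r. seq_scale (b j) (canonical_vec (i j)))})"
      unfolding large_orbit_def Let_def q funpow_finite_sum by blast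
    have "(\<Sum>j=1..r. seq_scale (b j) (canonical_vec (i j))) \<in> span (canonical_vec ` I)"
      using rib(1) by (intro span_sum span_scale span_base) auto
    with rib(2,3) show ?R
      by blast
  next
    assume ?R
    then obtain v where v: "v \<in> span (canonical_vec ` I)" "p (max m k) v \<noteq> 0"
      "(1 - 1 / real k) * real N
         < real (card {n\<in>{1..N}. real k < p m ((backward_shift w ^^ n) v) / p (max m k) v})"
      by blast
    define F where "F = {i. v i \<noteq> 0}"
    have F: "finite F" "F \<subseteq> I"
      unfolding F_def by (rule span_canonical_vec_finite_support[OF v(1)])+
    obtain h where h: "bij_betw h {1..card F} F"
      using ex_bij_betw_nat_finite_1[OF F(1)] by blast
    have vF: "v = (\<Sum>i\<in>F. seq_scale (v i) (canonical_vec i))"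
      unfolding sum_canonical_vec[OF F(1)] by (auto simp: F_def)
    also have "\<dots> = (\<Sum>j=1..card F. seq_scale (v (h j)) (canonical_vec (h j)))"
      by (rule sum.reindex_bij_betw[OF h, symmetric])
    finally have vh: "v = (\<Sum>j=1..card F. seq_scale (v (h j)) (canonical_vec (h j)))" .
    have r: "1 \<le> card F"
    proof (rule ccontr)
      assume "\<not> 1 \<le> card F"
      then have "card F = 0"
        by simp
      with F(1) have "F = {}"
        by simp
      then have v0: "v = 0"
        using vF by simp
      have "p (max m k) 0 = 0"
        by (rule seminorm_zero[OF seminorms]) (use k in simp)
      with v(2) v0 show False
        by simp
    qed
    have hF: "h j \<in> I \<and> v (h j) \<noteq> 0" if "j \<in> {1..card F}" for j
      using bij_betwE[OF h] that F(2) by (auto simp: F_def)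
    show "large_orbit I m k N"
      unfolding large_orbit_def Let_def q funpow_finite_sum[symmetric]
    proof (intro exI conjI ballI)
      show "1 \<le> card F" by (fact r)
      show "h j \<in> I" "v (h j) \<noteq> 0" if "j \<in> {1..card F}" for j
        using hF[OF that] by auto
    qed (unfold vh[symmetric], rule v(2), rule v(3))
  qed
qed

section \<open>Necessity of (A) and (B)\<close>

lemma chaotic_imp_large_orbits:
  assumes "distributionally_chaotic X (frechet_dist X p) (backward_shift w)"
  obtains D I m N where "D \<subseteq> {1..}" "upper_density D = 1"
    "\<forall>i\<in>I. limitin mtopology (\<lambda>n. seq_scale (weight_prod w i n) (canonical_vec (i - int n))) 0
       (inf sequentially (principal D))"
    "1 \<le> m" "\<forall>k\<ge>1. 1 \<le> N k" "strict_mono N" "\<forall>k\<ge>1. large_orbit I m k (N k)"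
proof -
  obtain u D m0 \<delta> where u: "u \<in> X" "u \<noteq> 0" and D: "D \<subseteq> {1..}" "full_density (\<lambda>n. n \<in> D)"
    and small: "\<And>k e. 1 \<le> k \<Longrightarrow> 0 < e \<Longrightarrow>
      \<exists>n0. \<forall>n\<in>D. n0 \<le> n \<longrightarrow> p k ((backward_shift w ^^ n) u) < e"
    and \<delta>: "0 < \<delta>" and m0: "1 \<le> m0"
    and large: "\<And>m. m0 \<le> m \<Longrightarrow> full_density (\<lambda>n. \<delta> \<le> p m ((backward_shift w ^^ n) u))"
    by (rule distributionally_chaoticD[OF assms]) (rule that)
  \<comment> \<open>Collecting the supports of all T^s u puts every truncation of every T^s u into
    the span.\<close>
  define I where "I = {i. \<exists>s. (backward_shift w ^^ s) u i \<noteq> 0}"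
  have null: "limitin mtopology (\<lambda>n. seq_scale (weight_prod w i n) (canonical_vec (i - int n))) 0
       (inf sequentially (principal D))" if i: "i \<in> I" for i
    unfolding frechet_limitin_iff
  proof (intro conjI allI impI zero_in)
    fix k :: nat and e :: real
    assume k: "1 \<le> k" and e: "0 < e"
    obtain s where s: "(backward_shift w ^^ s) u i \<noteq> 0"
      using i by (auto simp: I_def)
    define x where "x = (backward_shift w ^^ s) u"
    have x: "x \<in> X" "x i \<noteq> 0"
      using u s by (auto simp: x_def)
    obtain k' C where k': "1 \<le> k'"
      and C: "\<And>n y. y \<in> X \<Longrightarrow> p k (seq_scale (y n) (canonical_vec n)) \<le> C * p k' y"
      using basis_terms_equicontinuous[OF basis k] by metis
    \<comment> \<open>The coordinate of T^n x at i - n is the weight product times x i, so the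
      estimate is divided by the norm of x i; \<bar>C\<bar> + 1 is positive whatever C is.\<close>
    define e' where "e' = e * norm (x i) / (\<bar>C\<bar> + 1)"
    have e': "0 < e'"
      using e x by (simp add: e'_def)
    obtain k'' d where k'': "1 \<le> k''" "0 < d"
      and d: "\<And>n y. n \<le> s \<Longrightarrow> y \<in> X \<Longrightarrow> p k'' y < d \<Longrightarrow> p k' ((backward_shift w ^^ n) y) < e'"
      using funpow_small[OF k' e', of 0 s] by metis
    obtain n0 where n0: "\<forall>n\<in>D. n0 \<le> n \<longrightarrow> p k'' ((backward_shift w ^^ n) u) < d"
      using small[OF k''] by blast
    have "p k (seq_scale (weight_prod w i n) (canonical_vec (i - int n))) < e"
      if n: "n \<in> D" "n0 \<le> n" for n
    proof -
      define y where "y = (backward_shift w ^^ n) x"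
      have y: "y \<in> X"
        using x by (auto simp: y_def)
      \<comment> \<open>Here n, not n + s, lies in D. Swapping the powers lets the continuity of the
        fixed power s carry the smallness of T^n u over to T^n x.\<close>
      have "y = (backward_shift w ^^ s) ((backward_shift w ^^ n) u)"
        by (metis x_def y_def add.commute comp_apply funpow_add)
      then have py: "p k' y < e'"
        using d[of s "(backward_shift w ^^ n) u"] n0 n u by auto
      have "seq_scale (y (i - int n)) (canonical_vec (i - int n))
          = seq_scale (x i) (seq_scale (weight_prod w i n) (canonical_vec (i - int n)))"
        by (simp add: y_def backward_shift_funpow_nth seq_scale_def mult.assoc mult.left_commute)
      then have "norm (x i) * p k (seq_scale (weight_prod w i n) (canonical_vec (i - int n)))
          = p k (seq_scale (y (i - int n)) (canonical_vec (i - int n)))"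
        by (simp only: seminorm_scale[OF seminorms[OF k] scale_in[OF canonical_vec_in[OF basis]]])
      also have "\<dots> \<le> C * p k' y"
        by (rule C[OF y])
      also have "\<dots> \<le> (\<bar>C\<bar> + 1) * p k' y"
        using seminorm_nonneg[OF seminorms[OF k'] y] by (intro mult_right_mono) auto
      also have "\<dots> < (\<bar>C\<bar> + 1) * e'"
        using py by (intro mult_strict_left_mono) auto
      also have "\<dots> = norm (x i) * e"
        by (simp add: e'_def add_nonneg_eq_0_iff)
      finally show ?thesis
        using x(2) by simp
    qed
    then have "\<forall>n\<ge>n0. n \<in> D \<longrightarrow>
        p k (seq_scale (weight_prod w i n) (canonical_vec (i - int n)) - 0) < e"
      by simp
    then show "\<forall>\<^sub>F n in inf sequentially (principal D).
        seq_scale (weight_prod w i n) (canonical_vec (i - int n)) \<in> X \<and>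
        p k (seq_scale (weight_prod w i n) (canonical_vec (i - int n)) - 0) < e"
      unfolding eventually_inf_principal eventually_sequentially
      using canonical_vec_in[OF basis] scale_in by blast
  qed
  obtain i0 where i0: "u i0 \<noteq> 0"
    using u(2) by (auto simp: fun_eq_iff)
  have i0I: "i0 \<in> I"
    unfolding I_def using i0 by (intro CollectI exI[of _ 0]) simp
  \<comment> \<open>Continuity of the coordinate i0 yields a seminorm that does not vanish on this
    vector; small multiples of it will repair zero denominators.\<close>
  have "\<exists>m1\<ge>1. p m1 (canonical_vec i0) \<noteq> 0"
  proof -
    obtain k C where "1 \<le> k" "\<And>x. x \<in> X \<Longrightarrow> norm (x i0) \<le> C * p k x"
      using continuous_seminorm_coordinate[of i0] unfolding continuous_seminorm_def by blast
    from this(1) this(2)[OF canonical_vec_in[OF basis, of i0]] show ?thesis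
      by (intro exI[of _ k]) (auto simp: canonical_vec_def)
  qed
  then obtain m1 where m1: "1 \<le> m1" "p m1 (canonical_vec i0) \<noteq> 0"
    by blast
  define m where "m = max m0 m1"
  have m: "1 \<le> m" "m0 \<le> m" "m1 \<le> m"
    using m0 by (auto simp: m_def)
  note e_in = canonical_vec_in[OF basis]
  have step: "\<exists>N\<ge>K. large_orbit I m k N" if k: "1 \<le> k" for k K
  proof -
    define q where "q = max m k"
    have q: "1 \<le> q" "m1 \<le> q" "m \<le> q"
      using m by (auto simp: q_def)
    note sq = seminorms[OF q(1)] and sm = seminorms[OF m(1)]
    have "0 < p m1 (canonical_vec i0)"
      using m1 seminorm_nonneg[OF seminorms[OF m1(1)] e_in[of i0]] by simp
    also have "p m1 (canonical_vec i0) \<le> p q (canonical_vec i0)"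
      by (rule seminorms_mono[OF m1(1) q(2) e_in])
    finally have pe: "0 < p q (canonical_vec i0)" .
    \<comment> \<open>A numerator above \<delta> / 2 over a denominator below \<eta> gives a ratio
      above k.\<close>
    define \<eta> where "\<eta> = \<delta> / (2 * real k)"
    have \<eta>: "0 < \<eta>"
      using \<delta> k by (simp add: \<eta>_def)
    obtain n0 where n0: "\<forall>n\<in>D. n0 \<le> n \<longrightarrow> p q ((backward_shift w ^^ n) u) < \<eta> / 2"
      using small[OF q(1), of "\<eta> / 2"] \<eta> by auto
    obtain s where s: "n0 \<le> s" "s \<in> D"
      using full_density_infinite[OF D(2)] by blast
    define x where "x = (backward_shift w ^^ s) u"
    have x: "x \<in> X" "p q x < \<eta> / 2"
      using u n0 s by (auto simp: x_def)
    have "full_density (\<lambda>n. \<delta> \<le> p m ((backward_shift w ^^ n) x))"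
      using full_density_shift[OF large[OF m(2)], of s] by (simp add: x_def funpow_add)
    then obtain N where N: "K \<le> N"
      "(1 - 1 / real k) * real N < real (card {n\<in>{1..N}. \<delta> \<le> p m ((backward_shift w ^^ n) x)})"
      using full_densityD[of _ "1 / real k" K] k by auto
    \<comment> \<open>The accuracy of the truncation is chosen only after s and N, since it must
      control the first N iterates.\<close>
    obtain k' d where k': "q \<le> k'" "1 \<le> k'" "0 < d"
      and d: "\<And>n y. n \<le> N \<Longrightarrow> y \<in> X \<Longrightarrow> p k' y < d \<Longrightarrow> p m ((backward_shift w ^^ n) y) < \<delta> / 2"
      using funpow_small[OF m(1) half_gt_zero[OF \<delta>], of q N] by metis
    note sk' = seminorms[OF k'(2)]
    \<comment> \<open>The bound d keeps the orbits of v and x within \<delta> / 2 of each other in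
      \<open>p m\<close> up to time N; \<eta> / 2 keeps the denominator below \<eta>.\<close>
    define d' where "d' = min d (\<eta> / 2)"
    have d': "0 < d'"
      using k' \<eta> by (simp add: d'_def)
    obtain F where F: "finite F" "p k' ((\<lambda>i. if i \<in> F then x i else 0) - x) < d' / 2"
      by (rule finite_truncation[OF basis x(1) k'(2) half_gt_zero[OF d']])
    define t where "t = (\<Sum>i\<in>F. seq_scale (x i) (canonical_vec i))"
    have tX: "t \<in> X"
      unfolding t_def by (intro subspace_sum[OF subspace_carrier] scale_in e_in)
    have tx: "p k' (t - x) < d' / 2"
      using F(2) by (simp add: t_def sum_canonical_vec[OF F(1)])
    have t_span: "t \<in> span (canonical_vec ` I)"
      unfolding t_def
    proof (rule span_sum)
      fix i assume "i \<in> F"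
      show "seq_scale (x i) (canonical_vec i) \<in> span (canonical_vec ` I)"
      proof (cases "x i = 0")
        case True
        then have "seq_scale (x i) (canonical_vec i) = 0"
          by (simp add: seq_scale_def zero_fun_def)
        then show ?thesis
          using span_zero by metis
      next
        case False
        then have "i \<in> I"
          unfolding I_def x_def by blast
        then show ?thesis
          by (intro span_scale span_base) auto
      qed
    qed
    \<comment> \<open>If \<open>p q t\<close> = 0, adding z gives \<open>p q (t + z)\<close> \<ge>
      \<open>p q z\<close> > 0, and the half of d' left over by the truncation pays for z.\<close>
    obtain v where v: "v \<in> X" "v \<in> span (canonical_vec ` I)" "p q v \<noteq> 0" "p k' (v - x) < d'"
    proof (cases "p q t = 0")
      case False
      with that[of t] tX t_span tx d' show thesis
        by simp
    next
      case True
      define \<alpha> where "\<alpha> = d' / (2 * (p k' (canonical_vec i0) + 1))"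
      have pk': "0 \<le> p k' (canonical_vec i0)"
        by (rule seminorm_nonneg[OF sk' e_in])
      then have \<alpha>: "0 < \<alpha>" "\<alpha> * p k' (canonical_vec i0) \<le> d' / 2"
        using d' by (auto simp: \<alpha>_def field_simps)
      define z where "z = seq_scale (of_real \<alpha>) (canonical_vec i0 :: int \<Rightarrow> 'k)"
      have z: "z \<in> X" "z \<in> span (canonical_vec ` I)"
        using i0I by (auto simp: z_def e_in intro: span_scale span_base)
      have pz: "p j z = \<alpha> * p j (canonical_vec i0)" if "1 \<le> j" for j
        using \<alpha>(1) by (simp add: z_def seminorm_scale[OF seminorms[OF that] e_in])
      have "p q z \<le> p q (z + t) + p q t"
        by (rule seminorm_le_add_plus[OF sq z(1) tX])
      moreover have "0 < p q z"
        using pz[OF q(1)] pe \<alpha> by simp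
      ultimately have "p q (t + z) \<noteq> 0"
        using True by (simp add: add.commute)
      moreover have "p k' ((t - x) + z) \<le> p k' (t - x) + p k' z"
        by (intro seminorm_triangle[OF sk'] diff_in tX x z)
      then have "p k' (t + z - x) < d'"
        using tx pz[OF k'(2)] \<alpha>(2) by (simp add: algebra_simps)
      ultimately show thesis
        using tX z t_span by (intro that[of "t + z"] add_in span_add)
    qed
    have "p q (v - x) \<le> p k' (v - x)"
      by (rule seminorms_mono[OF q(1) k'(1) diff_in[OF v(1) x(1)]])
    then have "p q v < \<eta>"
      using seminorm_le_add_diff[OF sq v(1) x(1)] x(2) v(4) by (simp add: d'_def)
    have "0 < p q v"
      using seminorm_nonneg[OF sq v(1)] v(3) by simp
    have big: "real k < p m ((backward_shift w ^^ n) v) / p q v"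
      if n: "n \<le> N" "\<delta> \<le> p m ((backward_shift w ^^ n) x)" for n
    proof -
      have "p k' (x - v) < d"
        using v(4) seminorm_diff_commute[OF sk' v(1) x(1)] by (simp add: d'_def)
      then have "p m ((backward_shift w ^^ n) (x - v)) < \<delta> / 2"
        using d[OF n(1)] x(1) v(1) by blast
      moreover have "p m ((backward_shift w ^^ n) x) \<le> p m ((backward_shift w ^^ n) v)
          + p m ((backward_shift w ^^ n) x - (backward_shift w ^^ n) v)"
        by (intro seminorm_le_add_diff[OF sm] funpow_in x v)
      ultimately have "\<delta> / 2 < p m ((backward_shift w ^^ n) v)"
        using n(2) by (simp add: funpow_map_diff[OF x(1) v(1)])
      moreover have "real k * p q v < real k * \<eta>"
        using \<open>p q v < \<eta>\<close> k by simp
      moreover have "real k * \<eta> = \<delta> / 2"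
        using k by (simp add: \<eta>_def)
      ultimately have "real k * p q v < p m ((backward_shift w ^^ n) v)"
        by linarith
      then show ?thesis
        by (simp only: pos_less_divide_eq[OF \<open>0 < p q v\<close>])
    qed
    have "card {n\<in>{1..N}. \<delta> \<le> p m ((backward_shift w ^^ n) x)}
        \<le> card {n\<in>{1..N}. real k < p m ((backward_shift w ^^ n) v) / p q v}"
      by (rule card_mono) (use big in auto)
    with N(2) have "(1 - 1 / real k) * real N
        < real (card {n\<in>{1..N}. real k < p m ((backward_shift w ^^ n) v) / p q v})"
      by linarith
    with v(2,3) have "large_orbit I m k N"
      unfolding large_orbit_iff[OF k] q_def by blast
    with N(1) show ?thesis by blast
  qed
  have "\<exists>N. (\<forall>k\<ge>1. large_orbit I m k (N k) \<and> 1 \<le> N k) \<and> strict_mono N"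
    by (rule strictly_increasing_choice) (rule step)
  then obtain N where N: "\<forall>k\<ge>1. large_orbit I m k (N k) \<and> 1 \<le> N k" "strict_mono N"
    by blast
  have "upper_density D = 1"
    using D(2) by (simp add: upper_density_eq_1_iff)
  with D(1) null m(1) N show ?thesis
    by (intro that[of D I m N]) auto
qed

section \<open>Sufficiency of (A) and (B)\<close>

lemma large_orbits_imp_chaotic:
  assumes D: "upper_density D = 1"
    and null: "\<forall>i\<in>I. limitin mtopology
      (\<lambda>n. seq_scale (weight_prod w i n) (canonical_vec (i - int n))) 0
       (inf sequentially (principal D))"
    and m: "1 \<le> m" and N: "\<forall>k\<ge>1. 1 \<le> N k" "strict_mono_on {1..} N"
    and large: "\<forall>k\<ge>1. large_orbit I m k (N k)"
  shows "distributionally_chaotic X (frechet_dist X p) (backward_shift w)"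
proof (rule distributional_chaos_criterion[of "span (canonical_vec ` I)" D m])
  note e_in = canonical_vec_in[OF basis]
  let ?T = "\<lambda>n. backward_shift w ^^ n"
  \<comment> \<open>Because D is common to all i, the vectors whose orbits tend to 0 along D form a
    subspace, so (A) on the generators suffices.\<close>
  define S where "S = {v\<in>X. \<forall>k\<ge>1. \<forall>e>0. \<exists>n0. \<forall>n\<in>D. n0 \<le> n \<longrightarrow> p k (?T n v) < e}"
  have "subspace S"
    unfolding subspace_def
  proof (intro conjI ballI allI)
    show "0 \<in> S"
      by (auto simp: S_def funpow_map_zero seminorm_zero[OF seminorms])
  next
    fix x y assume xy: "x \<in> S" "y \<in> S"
    then have X: "x \<in> X" "y \<in> X"
      by (auto simp: S_def)
    have "\<exists>n0. \<forall>n\<in>D. n0 \<le> n \<longrightarrow> p k (?T n (x + y)) < e" if k: "1 \<le> k" and e: "0 < e" for k e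
    proof -
      obtain n1 n2 where n12: "\<forall>n\<in>D. n1 \<le> n \<longrightarrow> p k (?T n x) < e / 2"
        "\<forall>n\<in>D. n2 \<le> n \<longrightarrow> p k (?T n y) < e / 2"
        using xy k half_gt_zero[OF e] unfolding S_def by blast
      have "p k (?T n (x + y)) < e" if "n \<in> D" "max n1 n2 \<le> n" for n
      proof -
        have "p k (?T n x) < e / 2" "p k (?T n y) < e / 2"
          using n12 that by auto
        moreover have "p k (?T n (x + y)) \<le> p k (?T n x) + p k (?T n y)"
          unfolding funpow_map_add[OF X] by (intro seminorm_triangle[OF seminorms[OF k]] funpow_in X)
        ultimately show ?thesis
          by linarith
      qed
      then show ?thesis by blast
    qed
    with X show "x + y \<in> S"
      by (auto simp: S_def)
  next
    fix c x assume x: "x \<in> S"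
    then have X: "x \<in> X"
      by (auto simp: S_def)
    have "\<exists>n0. \<forall>n\<in>D. n0 \<le> n \<longrightarrow> p k (?T n (seq_scale c x)) < e" if k: "1 \<le> k" and e: "0 < e" for k e
    proof -
      have pos: "0 < norm c + 1"
        by (simp add: add_nonneg_pos)
      obtain n1 where n1: "\<forall>n\<in>D. n1 \<le> n \<longrightarrow> p k (?T n x) < e / (norm c + 1)"
        using x k divide_pos_pos[OF e pos] unfolding S_def by blast
      have "p k (?T n (seq_scale c x)) < e" if "n \<in> D" "n1 \<le> n" for n
      proof -
        have "p k (?T n (seq_scale c x)) = norm c * p k (?T n x)"
          unfolding funpow_map_scale[OF X] by (rule seminorm_scale[OF seminorms[OF k] funpow_in[OF X]])
        also have "\<dots> \<le> (norm c + 1) * p k (?T n x)"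
          using seminorm_nonneg[OF seminorms[OF k] funpow_in[OF X]] by (intro mult_right_mono) auto
        also have "\<dots> < e"
          using n1 that pos by (simp add: field_simps)
        finally show ?thesis .
      qed
      then show ?thesis by blast
    qed
    with X show "seq_scale c x \<in> S"
      by (auto simp: S_def)
  qed
  moreover have "canonical_vec ` I \<subseteq> S"
  proof safe
    fix i assume "i \<in> I"
    with null have "limitin mtopology (\<lambda>n. ?T n (canonical_vec i)) 0 (inf sequentially (principal D))"
      unfolding backward_shift_funpow_canonical_vec by blast
    then have "\<forall>k\<ge>1. \<forall>e>0. \<exists>n0. \<forall>n\<ge>n0. n \<in> D \<longrightarrow> p k (?T n (canonical_vec i)) < e"
      unfolding frechet_limitin_iff eventually_inf_principal eventually_sequentially diff_zero
      by blast
    then show "canonical_vec i \<in> S"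
      unfolding S_def using e_in by blast
  qed
  ultimately have S: "span (canonical_vec ` I) \<subseteq> S"
    by (intro span_minimal)
  then show "span (canonical_vec ` I) \<subseteq> X"
    by (auto simp: S_def)
  show "\<exists>n0. \<forall>n\<in>D. n0 \<le> n \<longrightarrow> p k (?T n v) < e"
    if "v \<in> span (canonical_vec ` I)" "1 \<le> k" "0 < e" for v k e
    using S that unfolding S_def by blast
  show "full_density (\<lambda>n. n \<in> D)"
    using D by (simp add: upper_density_eq_1_iff)
  fix k :: nat assume k: "1 \<le> k"
  \<comment> \<open>Positivity and strict increase from index 1 on supply the arbitrarily large
    lengths that the criterion asks for.\<close>
  have "k \<le> N k"
    using k
  proof (induction k rule: nat_induct_at_least)
    case base
    then show ?case using N(1) by simp
  next
    case (Suc k)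
    then have "N k < N (Suc k)"
      using strict_mono_onD[OF N(2), of k "Suc k"] by simp
    with Suc show ?case by simp
  qed
  have "large_orbit I m k (N k)"
    using large k by blast
  then obtain v where v: "v \<in> span (canonical_vec ` I)" "p (max m k) v \<noteq> 0"
    "(1 - 1 / real k) * real (N k)
        < real (card {n\<in>{1..N k}. real k < p m (?T n v) / p (max m k) v})"
    unfolding large_orbit_iff[OF k] by (elim bexE conjE)
  show "\<exists>v\<in>span (canonical_vec ` I). \<exists>N\<ge>k. p (max m k) v \<noteq> 0 \<and>
      (1 - 1 / real k) * real N
        < real (card {n\<in>{1..N}. real k < p m (?T n v) / p (max m k) v})"
    by (intro bexI[OF _ v(1)] exI[of _ "N k"] conjI \<open>k \<le> N k\<close> v(2,3))
qed (rule subspace_span m)+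

end

theorem theorem12:
  fixes X :: "(int \<Rightarrow> 'k::{real_normed_field,banach}) set"
    and p :: "nat \<Rightarrow> (int \<Rightarrow> 'k) \<Rightarrow> real"
    and w :: "int \<Rightarrow> 'k"
  assumes "frechet_sequence_space X p"
    and "canonical_basis X p"
    and "\<And>n. w n \<noteq> 0"
    and "backward_shift w ` X \<subseteq> X"
    and "continuous_map (frechet_topology X p) (frechet_topology X p) (backward_shift w)"
  shows "distributionally_chaotic X (frechet_dist X p) (backward_shift w) \<longleftrightarrow>
    (\<exists>(D :: nat set) (I :: int set). D \<subseteq> {1..} \<and> upper_density D = 1 \<and>
      (\<forall>i\<in>I. limitin (frechet_topology X p)
         (\<lambda>n. seq_scale (weight_prod w i n) (canonical_vec (i - int n))) 0
         (inf sequentially (principal D))) \<and>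
      (\<exists>(m :: nat) (N :: nat \<Rightarrow> nat). 1 \<le> m \<and> (\<forall>k\<ge>1. 1 \<le> N k) \<and> strict_mono_on {1..} N \<and>
        (\<forall>k\<ge>1. \<exists>(r :: nat) (i :: nat \<Rightarrow> int) (b :: nat \<Rightarrow> 'k).
          let q = (if k \<le> m then m else k);
              v = (\<Sum>j=1..r. seq_scale (b j) (canonical_vec (i j)))
          in 1 \<le> r \<and> (\<forall>j\<in>{1..r}. i j \<in> I \<and> b j \<noteq> 0) \<and>
             p q v \<noteq> 0 \<and>
             real (card {n\<in>{1..N k}.
               p m (\<Sum>j=1..r. seq_scale (b j * weight_prod w (i j) n) (canonical_vec (i j - int n)))
                 / p q v > real k})
               > (1 - 1 / real k) * real (N k))))"
proof -
  interpret weighted_shift X p w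
    using assms by (simp add: weighted_shift_def weighted_shift_axioms_def)
  show ?thesis
    unfolding large_orbit_def[symmetric]
  proof (intro iffI)
    assume "distributionally_chaotic X (frechet_dist X p) (backward_shift w)"
    then obtain D I m N where "D \<subseteq> {1..}" "upper_density D = 1"
      "\<forall>i\<in>I. limitin mtopology (\<lambda>n. seq_scale (weight_prod w i n) (canonical_vec (i - int n))) 0
         (inf sequentially (principal D))"
      "1 \<le> m" "\<forall>k\<ge>1. 1 \<le> N k" "strict_mono N" "\<forall>k\<ge>1. large_orbit I m k (N k)"
      by (rule chaotic_imp_large_orbits)
    moreover have "strict_mono_on {1..} N"
      using \<open>strict_mono N\<close> by (simp add: strict_mono_on_def strict_mono_def)
    ultimately show "\<exists>D I. D \<subseteq> {1..} \<and> upper_density D = 1 \<and>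
      (\<forall>i\<in>I. limitin mtopology (\<lambda>n. seq_scale (weight_prod w i n) (canonical_vec (i - int n))) 0
         (inf sequentially (principal D))) \<and>
      (\<exists>m N. 1 \<le> m \<and> (\<forall>k\<ge>1. 1 \<le> N k) \<and> strict_mono_on {1..} N \<and> (\<forall>k\<ge>1. large_orbit I m k (N k)))"
      by blast
  next
    assume "\<exists>D I. D \<subseteq> {1..} \<and> upper_density D = 1 \<and>
      (\<forall>i\<in>I. limitin mtopology (\<lambda>n. seq_scale (weight_prod w i n) (canonical_vec (i - int n))) 0
         (inf sequentially (principal D))) \<and>
      (\<exists>m N. 1 \<le> m \<and> (\<forall>k\<ge>1. 1 \<le> N k) \<and> strict_mono_on {1..} N \<and> (\<forall>k\<ge>1. large_orbit I m k (N k)))"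
    then show "distributionally_chaotic X (frechet_dist X p) (backward_shift w)"
      by (elim exE conjE) (rule large_orbits_imp_chaotic)
  qed
qed

end
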